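(* Suppose $n$ units are partitioned into $b$ blocks, block $c$ having $n_c\ge 2r$ units, with fixed potential outcomes $y_{kcs}\in\mathbb{R}$. Under balanced block randomization, for any treatments $s$ and $t$ with $s\neq t$: $$\mathbb{E}\big(\widehat{\mathrm{Var}}(\hat\delta_{st,\mathrm{diff}})\big)\ge\mathrm{Var}(\hat\delta_{st,\mathrm{diff}}),\qquad \mathbb{E}\big(\widehat{\mathrm{Var}}(\hat\delta_{st,\mathrm{HT}})\big)\ge\mathrm{Var}(\hat\delta_{st,\mathrm{HT}}),$$ and in each of these two inequalities equality holds if and only if, for each block $c$, there is a constant $a_c$ such that $y_{kcs}=a_c+y_{kct}$ for all $k\in\{1,\dots,n_c\}$.
   Context: There are $n$ units and $r$ treatments; each unit is assigned exactly one treatment. The units are partitioned into blocks $c=1,\dots,b$; block $c$ has $n_c$ units, $(k,c)$ denotes the $k$-th unit of block $c$ ($1\le k\le n_c$), and $z_c$ is the remainder of $n_c$ divided by $r$ ($0\le z_c<r$). Balanced block randomization means: independently across blocks, the treatment assignment within block $c$ is drawn uniformly at random from all balanced assignments of that block, i.e. assignments in which exactly $z_c$ of the treatments are each given to $\lfloor n_c/r\rfloor+1$ units and the other $r-z_c$ treatments are each given to $\lfloor n_c/r\rfloor$ units. $T_{kcs}$ is the indicator that unit $(k,c)$ receives treatment $s$, and $\#T_{cs}=\sum_{k=1}^{n_c}T_{kcs}$. The potential outcome $y_{kcs}$ of unit $(k,c)$ under treatment $s$ is non-random. The difference-in-means and Horvitz-Thompson estimators of the sample average treatment effect are $$\hat\delta_{st,\mathrm{diff}}=\sum_{c=1}^b\frac{n_c}{n}\sum_{k=1}^{n_c}\left(\frac{y_{kcs}T_{kcs}}{\#T_{cs}}-\frac{y_{kct}T_{kct}}{\#T_{ct}}\right),\qquad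 \hat\delta_{st,\mathrm{HT}}=\sum_{c=1}^b\frac{n_c}{n}\sum_{k=1}^{n_c}\left(\frac{y_{kcs}T_{kcs}}{n_c/r}-\frac{y_{kct}T_{kct}}{n_c/r}\right).$$ Block-level variance estimators: $$\hat\sigma^2_{cs,\mathrm{samp}}=\frac{n_c-1}{n_c}\sum_{k=1}^{n_c}\frac{T_{kcs}\left(y_{kcs}-\sum_{\ell=1}^{n_c}\frac{y_{\ell cs}T_{\ell cs}}{\#T_{cs}}\right)^2}{\#T_{cs}-1},$$ $$\hat\sigma^2_{cs,\mathrm{HT}}=\frac{(n_c-1)r}{n_c^2}\sum_{k=1}^{n_c}y_{kcs}^2T_{kcs}-\frac{(n_c-1)r^2}{n_c^2(n_c-r)+n_cz_c(r-z_c)}\sum_{k=1}^{n_c}\sum_{\ell\neq k}y_{kcs}y_{\ell cs}T_{kcs}T_{\ell cs}.$$ Estimators of the variances of the treatment effect estimators: $$\widehat{\mathrm{Var}}(\hat\delta_{st,\mathrm{diff}})=\sum_{c=1}^b\frac{n_c^2}{n^2}\left[\left(\frac{r}{n_c-1}+\frac{rz_c(r-z_c)}{(n_c-1)(n_c-z_c)(n_c+r-z_c)}\right)(\hat\sigma^2_{cs,\mathrm{samp}}+\hat\sigma^2_{ct,\mathrm{samp}})\right],$$ $$\widehat{\mathrm{Var}}(\hat\delta_{st,\mathrm{HT}})=\sum_{c=1}^b\frac{n_c^2}{n^2}\Bigg[\frac{r}{n_c-1}(\hat\sigma^2_{cs,\mathrm{HT}}+\hat\sigma^2_{ct,\mathrm{HT}})+\frac{r^2z_c(r-z_c)}{n_c^3(n_c-r)+n_c^2z_c(r-z_c)}\sum_{k=1}^{n_c}\sum_{\ell\neq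 k}\left(y_{kcs}y_{\ell cs}T_{kcs}T_{\ell cs}+y_{kct}y_{\ell ct}T_{kct}T_{\ell ct}\right)$$ $$\qquad\qquad+\frac{2r^2z_c(r-z_c)}{n_c^4(r-1)-n_c^2z_c(r-z_c)}\sum_{k=1}^{n_c}\sum_{\ell\neq k}y_{kcs}y_{\ell ct}T_{kcs}T_{\ell ct}\Bigg].$$ Sums $\sum_k\sum_{\ell\ne k}$ run over all ordered pairs of distinct indices in $\{1,\dots,n_c\}$. *)

theory Defs
  imports "HOL-Probability.Probability" "HOL-Probability.Product_PMF"
begin

text \<open>
  Conventions used throughout: the treatments are \<open>{1..r}\<close>, the blocks are \<open>{1..b}\<close>, block \<open>c\<close>
  has \<open>N c\<close> units, and unit \<open>(k,c)\<close> exists for \<open>k \<in> {1..N c}\<close>.  An assignment is a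
  function \<open>a\<close> such that \<open>a c k\<close> is the treatment of unit \<open>(k,c)\<close>.  The potential outcome of
  unit \<open>(k,c)\<close> under treatment \<open>s\<close> is \<open>y k c s\<close>.
\<close>

text \<open>
  Balanced assignments of one block of \<open>m\<close> units; \<open>Z\<close> is the set of the \<open>m mod r\<close> treatments
  that are given to one additional unit.
\<close>

definition balanced_assignments :: "nat \<Rightarrow> nat \<Rightarrow> (nat \<Rightarrow> nat) set" where
  "balanced_assignments r m =
     {w \<in> {1..m} \<rightarrow>\<^sub>E {1..r}.
        \<exists>Z \<subseteq> {1..r}. card Z = m mod r \<and>
          (\<forall>s \<in> Z. card {k \<in> {1..m}. w k = s} = m div r + 1) \<and>
          (\<forall>s \<in> {1..r} - Z. card {k \<in> {1..m}. w k = s} = m div r)}"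

text \<open>
  The two facts below ensure that \<^const>\<open>pmf_of_set\<close> really is the uniform distribution here.
\<close>

lemma finite_balanced_assignments: "finite (balanced_assignments r m)"
  unfolding balanced_assignments_def
  by (rule finite_subset[of _ "{1..m} \<rightarrow>\<^sub>E {1..r}"]) (auto intro: finite_PiE)

lemma card_residue_class:
  fixes r m j :: nat
  assumes "j < r"
  shows "card {k \<in> {1..m}. (k - 1) mod r = j} = m div r + (if j < m mod r then 1 else 0)"
proof (induction m)
  case 0
  then show ?case by simp
next
  case (Suc m)
  have "{k \<in> {1..Suc m}. (k - 1) mod r = j} =
      (if m mod r = j then insert (Suc m) {k \<in> {1..m}. (k - 1) mod r = j}
       else {k \<in> {1..m}. (k - 1) mod r = j})"
    by (auto simp: le_Suc_eq)
  moreover have "m mod r < r" using assms by simp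
  ultimately show ?case
    using Suc assms by (auto simp: mod_Suc div_Suc)
qed

lemma balanced_assignments_nonempty:
  assumes "r > 0"
  shows "balanced_assignments r m \<noteq> {}"
proof -
  define w where "w = restrict (\<lambda>k. (k - 1) mod r + 1) {1..m}"
  have count: "card {k \<in> {1..m}. w k = s} = m div r + (if s - 1 < m mod r then 1 else 0)"
    if "s \<in> {1..r}" for s
  proof -
    have "{k \<in> {1..m}. w k = s} = {k \<in> {1..m}. (k - 1) mod r = s - 1}"
      using that by (auto simp: w_def)
    moreover have "s - 1 < r" using that by auto
    ultimately show ?thesis
      using card_residue_class[of "s - 1" r m] by simp
  qed
  have "m mod r < r" using assms by simp
  have "w \<in> balanced_assignments r m"
    unfolding balanced_assignments_def
  proof (intro CollectI conjI exI[of _ "{1..m mod r}"] ballI)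
    show "w \<in> {1..m} \<rightarrow>\<^sub>E {1..r}"
      using assms by (auto simp: w_def Suc_le_eq)
  next
    show "{1..m mod r} \<subseteq> {1..r}"
      using \<open>m mod r < r\<close> by auto
  next
    fix s assume "s \<in> {1..m mod r}"
    then show "card {k \<in> {1..m}. w k = s} = m div r + 1"
      using count[of s] \<open>m mod r < r\<close> by auto
  next
    fix s assume "s \<in> {1..r} - {1..m mod r}"
    then show "card {k \<in> {1..m}. w k = s} = m div r"
      using count[of s] by auto
  qed simp
  then show ?thesis by blast
qed

definition balanced_block_randomization ::
    "nat \<Rightarrow> nat \<Rightarrow> (nat \<Rightarrow> nat) \<Rightarrow> (nat \<Rightarrow> nat \<Rightarrow> nat) pmf" where
  "balanced_block_randomization r b N =
     Pi_pmf {1..b} undefined (\<lambda>c. pmf_of_set (balanced_assignments r (N c)))"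

definition treat :: "(nat \<Rightarrow> nat \<Rightarrow> nat) \<Rightarrow> nat \<Rightarrow> nat \<Rightarrow> nat \<Rightarrow> real" where
  "treat a k c s = (if a c k = s then 1 else 0)"

definition num_treat :: "(nat \<Rightarrow> nat) \<Rightarrow> (nat \<Rightarrow> nat \<Rightarrow> nat) \<Rightarrow> nat \<Rightarrow> nat \<Rightarrow> real" where
  "num_treat N a c s = (\<Sum>k = 1..N c. treat a k c s)"

definition num_units :: "nat \<Rightarrow> (nat \<Rightarrow> nat) \<Rightarrow> nat" where
  "num_units b N = (\<Sum>c = 1..b. N c)"

definition delta_diff ::
    "nat \<Rightarrow> (nat \<Rightarrow> nat) \<Rightarrow> (nat \<Rightarrow> nat \<Rightarrow> nat \<Rightarrow> real) \<Rightarrow> nat \<Rightarrow> nat \<Rightarrow>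
     (nat \<Rightarrow> nat \<Rightarrow> nat) \<Rightarrow> real" where
  "delta_diff b N y s t a =
     (\<Sum>c = 1..b. real (N c) / real (num_units b N) *
        (\<Sum>k = 1..N c. y k c s * treat a k c s / num_treat N a c s
                     - y k c t * treat a k c t / num_treat N a c t))"

definition delta_HT ::
    "nat \<Rightarrow> nat \<Rightarrow> (nat \<Rightarrow> nat) \<Rightarrow> (nat \<Rightarrow> nat \<Rightarrow> nat \<Rightarrow> real) \<Rightarrow> nat \<Rightarrow> nat \<Rightarrow>
     (nat \<Rightarrow> nat \<Rightarrow> nat) \<Rightarrow> real" where
  "delta_HT r b N y s t a =
     (\<Sum>c = 1..b. real (N c) / real (num_units b N) *
        (\<Sum>k = 1..N c. y k c s * treat a k c s / (real (N c) / real r)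
                     - y k c t * treat a k c t / (real (N c) / real r)))"

definition sigma2_samp ::
    "(nat \<Rightarrow> nat) \<Rightarrow> (nat \<Rightarrow> nat \<Rightarrow> nat \<Rightarrow> real) \<Rightarrow> nat \<Rightarrow> nat \<Rightarrow>
     (nat \<Rightarrow> nat \<Rightarrow> nat) \<Rightarrow> real" where
  "sigma2_samp N y c s a =
     (real (N c) - 1) / real (N c) *
     (\<Sum>k = 1..N c.
        treat a k c s *
        (y k c s - (\<Sum>l = 1..N c. y l c s * treat a l c s / num_treat N a c s))\<^sup>2 /
        (num_treat N a c s - 1))"

definition sigma2_HT ::
    "nat \<Rightarrow> (nat \<Rightarrow> nat) \<Rightarrow> (nat \<Rightarrow> nat \<Rightarrow> nat \<Rightarrow> real) \<Rightarrow> nat \<Rightarrow> nat \<Rightarrow>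
     (nat \<Rightarrow> nat \<Rightarrow> nat) \<Rightarrow> real" where
  "sigma2_HT r N y c s a =
     (let nc = real (N c); \<rho> = real r; z = real (N c mod r) in
        (nc - 1) * \<rho> / nc\<^sup>2 * (\<Sum>k = 1..N c. (y k c s)\<^sup>2 * treat a k c s)
        - (nc - 1) * \<rho>\<^sup>2 / (nc\<^sup>2 * (nc - \<rho>) + nc * z * (\<rho> - z)) *
          (\<Sum>k = 1..N c. \<Sum>l \<in> {1..N c} - {k}.
             y k c s * y l c s * treat a k c s * treat a l c s))"

definition var_est_diff ::
    "nat \<Rightarrow> nat \<Rightarrow> (nat \<Rightarrow> nat) \<Rightarrow> (nat \<Rightarrow> nat \<Rightarrow> nat \<Rightarrow> real) \<Rightarrow> nat \<Rightarrow> nat \<Rightarrow>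
     (nat \<Rightarrow> nat \<Rightarrow> nat) \<Rightarrow> real" where
  "var_est_diff r b N y s t a =
     (\<Sum>c = 1..b.
        let n = real (num_units b N); nc = real (N c); \<rho> = real r; z = real (N c mod r) in
          nc\<^sup>2 / n\<^sup>2 *
          ((\<rho> / (nc - 1) + \<rho> * z * (\<rho> - z) / ((nc - 1) * (nc - z) * (nc + \<rho> - z))) *
           (sigma2_samp N y c s a + sigma2_samp N y c t a)))"

definition var_est_HT ::
    "nat \<Rightarrow> nat \<Rightarrow> (nat \<Rightarrow> nat) \<Rightarrow> (nat \<Rightarrow> nat \<Rightarrow> nat \<Rightarrow> real) \<Rightarrow> nat \<Rightarrow> nat \<Rightarrow>
     (nat \<Rightarrow> nat \<Rightarrow> nat) \<Rightarrow> real" where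
  "var_est_HT r b N y s t a =
     (\<Sum>c = 1..b.
        let n = real (num_units b N); nc = real (N c); \<rho> = real r; z = real (N c mod r) in
          nc\<^sup>2 / n\<^sup>2 *
          (\<rho> / (nc - 1) * (sigma2_HT r N y c s a + sigma2_HT r N y c t a)
           + \<rho>\<^sup>2 * z * (\<rho> - z) / (nc ^ 3 * (nc - \<rho>) + nc\<^sup>2 * z * (\<rho> - z)) *
             (\<Sum>k = 1..N c. \<Sum>l \<in> {1..N c} - {k}.
                y k c s * y l c s * treat a k c s * treat a l c s
                + y k c t * y l c t * treat a k c t * treat a l c t)
           + 2 * \<rho>\<^sup>2 * z * (\<rho> - z) / (nc ^ 4 * (\<rho> - 1) - nc\<^sup>2 * z * (\<rho> - z)) *
             (\<Sum>k = 1..N c. \<Sum>l \<in> {1..N c} - {k}.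
                y k c s * y l c t * treat a k c s * treat a l c t)))"

end

theory Submission
  imports Defs
begin

text \<open>
  Everything reduces to one block of \<open>m\<close> units with potential outcomes \<open>u\<close> and \<open>v\<close> under the two
  treatments.  The uniform distribution on balanced assignments is invariant under permutations of
  the units, so for every function \<open>F\<close> of the group sizes the expectation of \<open>F\<close> times a product of
  two treatment indicators is the same for all pairs of distinct units and is found by summing over
  all pairs.  It is also invariant under permutations of the treatments; as a group size takes only
  the two values \<open>m div r\<close> and \<open>m div r + 1\<close>, and the group sizes add up to \<open>m\<close>, all required moments
  of group sizes follow.  For both estimators the expected variance estimate exceeds the variance
  by the population variance of \<open>u - v\<close> divided by \<open>m - 1\<close>, which vanishes exactly when \<open>u - v\<close> is
  constant.  The blocks are independent, so these excesses add up with weights \<open>(N c / n)\<^sup>2\<close>.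
\<close>

subsection \<open>Sums of independent variables\<close>

text \<open>After centring, independence makes the expectation of every mixed product zero, so only
  the diagonal of the expanded square survives.\<close>

lemma (in prob_space) variance_sum_indep:
  fixes X :: "'i \<Rightarrow> 'a \<Rightarrow> real"
  assumes "finite I" and indep: "indep_vars (\<lambda>_. borel) X I"
    and int: "\<And>i. i \<in> I \<Longrightarrow> integrable M (X i)" "\<And>i. i \<in> I \<Longrightarrow> integrable M (\<lambda>x. (X i x)\<^sup>2)"
  shows "variance (\<lambda>x. \<Sum>i\<in>I. X i x) = (\<Sum>i\<in>I. variance (X i))"
proof -
  define Y where "Y = (\<lambda>i x. X i x - expectation (X i))"
  have Yint: "integrable M (Y i)" if "i \<in> I" for i
    using int that by (auto simp: Y_def)
  have Ymean: "expectation (Y i) = 0" if "i \<in> I" for i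
    using int(1)[OF that] by (simp add: Y_def prob_space)
  have Yindep: "indep_vars (\<lambda>_. borel) Y I"
    unfolding Y_def
    by (rule indep_vars_compose2[OF indep, where Y = "\<lambda>i x. x - expectation (X i)"]) simp
  have sq: "integrable M (\<lambda>x. Y i x * Y i x)" if "i \<in> I" for i
  proof -
    have "integrable M (\<lambda>x. (X i x)\<^sup>2 - 2 * expectation (X i) * X i x + (expectation (X i))\<^sup>2)"
      using int that by auto
    then show ?thesis
      by (simp add: Y_def power2_eq_square algebra_simps)
  qed
  have off: "integrable M (\<lambda>x. Y i x * Y j x) \<and> expectation (\<lambda>x. Y i x * Y j x) = 0"
    if "i \<in> I" "j \<in> I" "i \<noteq> j" for i j
  proof -
    have *: "indep_vars (\<lambda>_. borel) Y {i, j}"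
      by (rule indep_vars_subset[OF Yindep]) (use that in auto)
    have "integrable M (\<lambda>x. \<Prod>k\<in>{i, j}. Y k x)"
      by (rule indep_vars_integrable[OF _ *]) (use that Yint in auto)
    moreover have "expectation (\<lambda>x. \<Prod>k\<in>{i, j}. Y k x) = (\<Prod>k\<in>{i, j}. expectation (Y k))"
      by (rule indep_vars_lebesgue_integral[OF _ *]) (use that Yint in auto)
    ultimately show ?thesis
      using that Ymean by simp
  qed
  have ij: "integrable M (\<lambda>x. Y i x * Y j x)" if "i \<in> I" "j \<in> I" for i j
    using off[OF that] sq[OF that(1)] by (cases "i = j") auto
  have "variance (\<lambda>x. \<Sum>i\<in>I. X i x) = expectation (\<lambda>x. (\<Sum>i\<in>I. Y i x)\<^sup>2)"
    using int by (simp add: Y_def sum_subtractf)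
  also have "\<dots> = (\<Sum>i\<in>I. \<Sum>j\<in>I. expectation (\<lambda>x. Y i x * Y j x))"
    using ij by (simp add: power2_eq_square sum_product)
  also have "\<dots> = (\<Sum>i\<in>I. \<Sum>j\<in>I. if j = i then expectation (\<lambda>x. Y i x * Y i x) else 0)"
    using off by (intro sum.cong) auto
  also have "\<dots> = (\<Sum>i\<in>I. variance (X i))"
    using \<open>finite I\<close> by (simp add: Y_def power2_eq_square)
  finally show ?thesis .
qed

text \<open>The coordinates of a product distribution are independent with marginals
  \<open>p i\<close>, and finite supports make every function integrable.\<close>

lemma variance_sum_Pi_pmf:
  fixes f :: "'i \<Rightarrow> 'a \<Rightarrow> real"
  assumes "finite I" and fin: "\<And>i. i \<in> I \<Longrightarrow> finite (set_pmf (p i))"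
  shows "measure_pmf.variance (Pi_pmf I d p) (\<lambda>a. \<Sum>i\<in>I. f i (a i)) =
    (\<Sum>i\<in>I. measure_pmf.variance (p i) (f i))"
proof -
  let ?P = "Pi_pmf I d p"
  have fin': "finite (set_pmf ?P)"
    using assms by (auto simp: set_Pi_pmf intro!: finite_PiE_dflt)
  have "prob_space.indep_vars ?P (\<lambda>_. borel) (\<lambda>i a. f i (a i)) I"
    by (rule prob_space.indep_vars_compose2[OF prob_space_measure_pmf
        indep_vars_Pi_pmf[OF \<open>finite I\<close>]]) simp
  then have "measure_pmf.variance ?P (\<lambda>a. \<Sum>i\<in>I. f i (a i)) =
      (\<Sum>i\<in>I. measure_pmf.variance ?P (\<lambda>a. f i (a i)))"
    using fin' by (intro prob_space.variance_sum_indep prob_space_measure_pmf \<open>finite I\<close>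
        integrable_measure_pmf_finite)
  also have "\<dots> = (\<Sum>i\<in>I. measure_pmf.variance (map_pmf (\<lambda>a. a i) ?P) (f i))"
    by simp
  also have "\<dots> = (\<Sum>i\<in>I. measure_pmf.variance (p i) (f i))"
    by (intro sum.cong refl) (simp add: Pi_pmf_component \<open>finite I\<close>)
  finally show ?thesis .
qed

lemma expectation_sum_Pi_pmf:
  fixes f :: "'i \<Rightarrow> 'a \<Rightarrow> real"
  assumes "finite I" and fin: "\<And>i. i \<in> I \<Longrightarrow> finite (set_pmf (p i))"
  shows "measure_pmf.expectation (Pi_pmf I d p) (\<lambda>a. \<Sum>i\<in>I. f i (a i)) =
    (\<Sum>i\<in>I. measure_pmf.expectation (p i) (f i))"
proof -
  let ?P = "Pi_pmf I d p"
  have fin': "finite (set_pmf ?P)"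
    using assms by (auto simp: set_Pi_pmf intro!: finite_PiE_dflt)
  have "measure_pmf.expectation ?P (\<lambda>a. \<Sum>i\<in>I. f i (a i)) =
      (\<Sum>i\<in>I. measure_pmf.expectation (map_pmf (\<lambda>a. a i) ?P) (f i))"
    using fin' by (simp add: integrable_measure_pmf_finite)
  also have "\<dots> = (\<Sum>i\<in>I. measure_pmf.expectation (p i) (f i))"
    by (intro sum.cong refl) (simp add: Pi_pmf_component \<open>finite I\<close>)
  finally show ?thesis .
qed

subsection \<open>Permutation-invariant functions\<close>

text \<open>Recovers a single value from a sum: the transposition of \<open>k\<close> and
  \<open>i\<close> shows that \<open>h\<close> is constant on \<open>S\<close>.\<close>

lemma sum_permutation_invariant:
  fixes h :: "'a \<Rightarrow> real"
  assumes inv: "\<And>\<pi> i. \<pi> permutes S \<Longrightarrow> i \<in> S \<Longrightarrow> h (\<pi> i) = h i" and "k \<in> S"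
  shows "(\<Sum>i\<in>S. h i) = real (card S) * h k"
proof -
  have "h i = h k" if "i \<in> S" for i
    using inv[OF permutes_swap_id[OF \<open>k \<in> S\<close> that] \<open>k \<in> S\<close>] by simp
  then show ?thesis by simp
qed

text \<open>Permutations act transitively on ordered pairs of distinct elements, so \<open>g\<close>
  has a single value off the diagonal.\<close>

lemma sum_pairs_permutation_invariant:
  fixes g :: "'a \<Rightarrow> 'a \<Rightarrow> real"
  assumes "finite S"
    and inv: "\<And>\<pi> i j. \<pi> permutes S \<Longrightarrow> i \<in> S \<Longrightarrow> j \<in> S \<Longrightarrow> g (\<pi> i) (\<pi> j) = g i j"
    and kl: "k \<in> S" "l \<in> S" "k \<noteq> l"
  shows "(\<Sum>i\<in>S. \<Sum>j\<in>S - {i}. g i j) = real (card S) * (real (card S) - 1) * g k l"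
proof -
  have "g i j = g k l" if "i \<in> S" "j \<in> S" "i \<noteq> j" for i j
  proof -
    \<comment> \<open>The first swap sends \<open>k\<close> to \<open>i\<close> and \<open>l\<close>
      to \<open>l'\<close>; the second sends \<open>l'\<close> to \<open>j\<close> and fixes
      \<open>i\<close>, which differs from both \<open>l'\<close> and \<open>j\<close>.\<close>
    define l' where "l' = Transposition.transpose k i l"
    have l': "l' \<in> S" "l' \<noteq> i"
      using kl that by (auto simp: l'_def Transposition.transpose_def)
    define \<pi> where "\<pi> = Transposition.transpose l' j \<circ> Transposition.transpose k i"
    have "\<pi> permutes S"
      unfolding \<pi>_def using l' kl that by (intro permutes_compose permutes_swap_id)
    moreover have "\<pi> k = i" "\<pi> l = j"
      using l' that by (auto simp: \<pi>_def l'_def Transposition.transpose_def)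
    ultimately show ?thesis
      using inv[of \<pi> k l] kl by simp
  qed
  then have "(\<Sum>i\<in>S. \<Sum>j\<in>S - {i}. g i j) = (\<Sum>i\<in>S. \<Sum>j\<in>S - {i}. g k l)"
    by (intro sum.cong) auto
  also have "\<dots> = real (card S) * (real (card S) - 1) * g k l"
  proof -
    have "card S \<ge> 1"
      using kl \<open>finite S\<close> by (auto simp: Suc_le_eq card_gt_0_iff)
    then show ?thesis
      using \<open>finite S\<close> by (simp add: card_Diff_singleton of_nat_diff)
  qed
  finally show ?thesis .
qed

lemma sum_distinct_pairs:
  fixes u v :: "'a \<Rightarrow> real"
  assumes "finite S"
  shows "(\<Sum>i\<in>S. \<Sum>j\<in>S - {i}. u i * v j) = sum u S * sum v S - (\<Sum>i\<in>S. u i * v i)"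
proof -
  have "(\<Sum>i\<in>S. \<Sum>j\<in>S - {i}. u i * v j) = (\<Sum>i\<in>S. (\<Sum>j\<in>S. u i * v j) - u i * v i)"
    using assms by (intro sum.cong refl) (simp add: sum_diff1)
  then show ?thesis
    by (simp add: sum_subtractf sum_product)
qed

section \<open>Treatment indicators and group sizes in one block\<close>

text \<open>The counterpart of \<open>treat\<close> for the assignment \<open>w\<close> of a single
  block; \<open>group_size\<close> is likewise the counterpart of \<open>num_treat\<close>.\<close>

definition ind :: "(nat \<Rightarrow> nat) \<Rightarrow> nat \<Rightarrow> nat \<Rightarrow> real" where
  "ind w k s = (if w k = s then 1 else 0)"

definition group_size :: "nat \<Rightarrow> (nat \<Rightarrow> nat) \<Rightarrow> nat \<Rightarrow> real" where
  "group_size m w s = (\<Sum>k = 1..m. ind w k s)"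

lemma group_size_eq_card: "group_size m w s = real (card {k \<in> {1..m}. w k = s})"
  unfolding group_size_def ind_def by (simp add: sum.If_cases Int_def)

lemma ind_mult_self [simp]: "ind w k s * ind w k s = ind w k s"
  by (simp add: ind_def)

text \<open>Group sizes that take only the two allowed values and add up to \<open>m\<close> force
  exactly \<open>m mod r\<close> of them to be the larger one, which recovers the set
  \<open>Z\<close> of the definition. In this form, invariance under permutations is easy to
  check.\<close>

lemma balanced_assignments_iff:
  assumes "r > 0"
  shows "w \<in> balanced_assignments r m \<longleftrightarrow> w \<in> {1..m} \<rightarrow>\<^sub>E {1..r} \<and>
    (\<forall>s\<in>{1..r}. group_size m w s = real (m div r) \<or> group_size m w s = real (m div r) + 1)"
proof -
  let ?n = "\<lambda>s. card {k \<in> {1..m}. w k = s}"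
  have eq: "(group_size m w s = real (m div r) \<or> group_size m w s = real (m div r) + 1) \<longleftrightarrow>
    (?n s = m div r \<or> ?n s = m div r + 1)" for s
    unfolding group_size_eq_card by linarith
  have "\<exists>Z\<subseteq>{1..r}. card Z = m mod r \<and> (\<forall>s\<in>Z. ?n s = m div r + 1) \<and>
      (\<forall>s\<in>{1..r} - Z. ?n s = m div r)"
    if w: "w \<in> {1..m} \<rightarrow>\<^sub>E {1..r}" and n: "\<forall>s\<in>{1..r}. ?n s = m div r \<or> ?n s = m div r + 1"
  proof -
    \<comment> \<open>The treatments with an extra unit; \<open>card Z\<close> is found by counting
      all units treatment by treatment.\<close>
    define Z where "Z = {s \<in> {1..r}. ?n s = m div r + 1}"
    have "m = (\<Sum>s\<in>{1..r}. ?n s)"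
    proof -
      have "{1..m} = (\<Union>s\<in>{1..r}. {k \<in> {1..m}. w k = s})"
        using w by fastforce
      then have "card {1..m} = (\<Sum>s\<in>{1..r}. ?n s)"
        by (subst (1) \<open>{1..m} = _\<close>, subst card_UN_disjoint) auto
      then show ?thesis by simp
    qed
    also have "\<dots> = (\<Sum>s\<in>{1..r}. m div r + (if s \<in> Z then 1 else 0))"
      using n by (intro sum.cong) (auto simp: Z_def)
    also have "\<dots> = m div r * r + card Z"
      by (simp only: sum.distrib, simp add: sum.If_cases Z_def Int_def conj_commute)
    finally have "card Z = m mod r"
      using mult_div_mod_eq[of r m] by (metis add_left_cancel mult.commute)
    then show ?thesis
      using n by (intro exI[of _ Z]) (auto simp: Z_def)
  qed
  then show ?thesis
    unfolding balanced_assignments_def eq by blast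
qed

text \<open>The full double sum is a square, and idempotent indicators turn its diagonal into the
  subtracted sum.\<close>

lemma sum_pairs_same_group:
  "(\<Sum>k = 1..m. \<Sum>l\<in>{1..m} - {k}. (u k * ind w k s) * (u l * ind w l s)) =
    (\<Sum>k = 1..m. u k * ind w k s)\<^sup>2 - (\<Sum>k = 1..m. (u k)\<^sup>2 * ind w k s)"
proof -
  have "(u k * ind w k s) * (u k * ind w k s) = (u k)\<^sup>2 * ind w k s" for k
    by (simp add: ind_def power2_eq_square)
  then show ?thesis
    by (simp only: sum_distinct_pairs finite_atLeastAtMost power2_eq_square)
qed

text \<open>No unit receives both treatments, so the diagonal of the product contributes
  nothing.\<close>

lemma sum_pairs_other_group:
  assumes "s \<noteq> t"
  shows "(\<Sum>k = 1..m. \<Sum>l\<in>{1..m} - {k}. (u k * ind w k s) * (v l * ind w l t)) =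
    (\<Sum>k = 1..m. u k * ind w k s) * (\<Sum>k = 1..m. v k * ind w k t)"
proof -
  have "(u k * ind w k s) * (v k * ind w k t) = 0" for k
    using assms by (simp add: ind_def)
  then show ?thesis
    by (simp only: sum_distinct_pairs finite_atLeastAtMost sum.neutral_const diff_zero)
qed

subsection \<open>Moments of a balanced assignment\<close>

text \<open>The bound \<open>2 * r \<le> m\<close> makes every group contain at least two units, so
  group sizes, and group sizes minus one, can serve as divisors.\<close>

locale balanced_block =
  fixes r m :: nat
  assumes r_ge_2: "2 \<le> r" and m_ge: "2 * r \<le> m"
begin

abbreviation assignment_pmf :: "(nat \<Rightarrow> nat) pmf" where
  "assignment_pmf \<equiv> pmf_of_set (balanced_assignments r m)"

abbreviation E :: "((nat \<Rightarrow> nat) \<Rightarrow> real) \<Rightarrow> real" where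
  "E f \<equiv> measure_pmf.expectation assignment_pmf f"

abbreviation A :: "(nat \<Rightarrow> nat) \<Rightarrow> nat \<Rightarrow> real" where
  "A \<equiv> group_size m"

lemma nonempty: "balanced_assignments r m \<noteq> {}"
  using balanced_assignments_nonempty r_ge_2 by auto

lemma finite_set_assignment_pmf: "finite (set_pmf assignment_pmf)"
  by (simp add: nonempty finite_balanced_assignments)

lemma integrable_assignment [simp, intro]: "integrable assignment_pmf (f :: _ \<Rightarrow> real)"
  by (rule integrable_measure_pmf_finite[OF finite_set_assignment_pmf])

lemma E_cong: "(\<And>w. w \<in> balanced_assignments r m \<Longrightarrow> f w = g w) \<Longrightarrow> E f = E g"
  by (simp add: integral_pmf_of_set nonempty finite_balanced_assignments)

section \<open>Invariance under permutations of units and of treatments\<close>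

lemma E_bij:
  assumes "bij_betw \<phi> (balanced_assignments r m) (balanced_assignments r m)"
  shows "E (\<lambda>w. f (\<phi> w)) = E f"
proof -
  have "E f = measure_pmf.expectation (map_pmf \<phi> assignment_pmf) f"
    by (simp add: map_pmf_of_set_bij_betw[OF assms nonempty finite_balanced_assignments])
  then show ?thesis by simp
qed

text \<open>An injective self-map of a finite set is onto, so for a relabelling only closure and
  injectivity remain to be checked.\<close>

lemma bij_betw_of_closed_inj:
  assumes "\<And>w. w \<in> balanced_assignments r m \<Longrightarrow> \<phi> w \<in> balanced_assignments r m"
    and "inj_on \<phi> (balanced_assignments r m)"
  shows "bij_betw \<phi> (balanced_assignments r m) (balanced_assignments r m)"
  using assms endo_inj_surj[OF finite_balanced_assignments, of \<phi> r m]
  by (auto simp: bij_betw_def)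

lemma group_size_unit_permute:
  assumes "\<pi> permutes {1..m}"
  shows "A (w \<circ> \<pi>) s = A w s"
  unfolding group_size_def
  using sum.permute[OF assms, of "\<lambda>k. ind w k s"] by (simp add: ind_def comp_def)

text \<open>Relabelling the units changes no group size, so it maps the balanced assignments
  bijectively to themselves.\<close>

lemma E_unit_permute:
  assumes \<pi>: "\<pi> permutes {1..m}"
  shows "E (\<lambda>w. f (w \<circ> \<pi>)) = E f"
proof (rule E_bij, rule bij_betw_of_closed_inj)
  show "inj_on (\<lambda>w. w \<circ> \<pi>) (balanced_assignments r m)"
    using permutes_surj[OF \<pi>] by (intro inj_onI) (metis surj_fun_eq)
next
  fix w assume "w \<in> balanced_assignments r m"
  moreover have "w \<circ> \<pi> \<in> {1..m} \<rightarrow>\<^sub>E {1..r}" if "w \<in> {1..m} \<rightarrow>\<^sub>E {1..r}"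
    using that permutes_in_image[OF \<pi>] by (fastforce simp: PiE_iff extensional_def)
  ultimately show "w \<circ> \<pi> \<in> balanced_assignments r m"
    using r_ge_2 by (auto simp: balanced_assignments_iff group_size_unit_permute[OF \<pi>])
qed

text \<open>\<open>restrict\<close> keeps the relabelled assignment extensional: outside
  \<open>{1..m}\<close>, plain composition with \<open>\<tau>\<close> could move the value
  \<open>undefined\<close>.\<close>

lemma group_size_treatment_permute:
  assumes "\<tau> permutes {1..r}"
  shows "A (restrict (\<tau> \<circ> w) {1..m}) (\<tau> s) = A w s"
  unfolding group_size_def ind_def
  using permutes_inj[OF assms] by (intro sum.cong) (auto simp: inj_eq)

text \<open>Relabelling only moves group sizes from one treatment to another, and balance treats all
  treatments alike.\<close>

lemma E_treatment_permute:
  assumes \<tau>: "\<tau> permutes {1..r}"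
  shows "E (\<lambda>w. f (restrict (\<tau> \<circ> w) {1..m})) = E f"
proof (rule E_bij, rule bij_betw_of_closed_inj)
  show "inj_on (\<lambda>w. restrict (\<tau> \<circ> w) {1..m}) (balanced_assignments r m)"
  proof (rule inj_onI)
    fix v w assume v: "v \<in> balanced_assignments r m" and w: "w \<in> balanced_assignments r m"
      and eq: "restrict (\<tau> \<circ> v) {1..m} = restrict (\<tau> \<circ> w) {1..m}"
    have "v k = w k" if "k \<in> {1..m}" for k
      using fun_cong[OF eq, of k] that permutes_inj[OF \<tau>] by (simp add: inj_eq)
    then show "v = w"
      using v w unfolding balanced_assignments_def
      by (intro PiE_ext[of v "{1..m}" "\<lambda>_. {1..r}" w]) auto
  qed
next
  fix w assume w: "w \<in> balanced_assignments r m"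
  have "A (restrict (\<tau> \<circ> w) {1..m}) s = A w (inv \<tau> s)" for s
    using group_size_treatment_permute[OF \<tau>, of w "inv \<tau> s"] permutes_inverses(1)[OF \<tau>] by simp
  moreover have "inv \<tau> s \<in> {1..r}" if "s \<in> {1..r}" for s
    using permutes_in_image[OF permutes_inv[OF \<tau>]] that by blast
  moreover have "restrict (\<tau> \<circ> w) {1..m} \<in> {1..m} \<rightarrow>\<^sub>E {1..r}"
    using w permutes_in_image[OF \<tau>] unfolding balanced_assignments_def by (auto simp: PiE_iff)
  ultimately show "restrict (\<tau> \<circ> w) {1..m} \<in> balanced_assignments r m"
    using w r_ge_2 by (simp add: balanced_assignments_iff)
qed

section \<open>Moments of unit indicators in terms of group sizes\<close>

text \<open>By exchangeability all units have the same expectation, and the indicators add up to the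
  group size; the factor \<open>F\<close> does not change when units are permuted.\<close>

lemma E_unit:
  assumes "k \<in> {1..m}"
  shows "E (\<lambda>w. F (A w s) * ind w k s) = E (\<lambda>w. F (A w s) * A w s) / m"
proof -
  have "(\<Sum>i\<in>{1..m}. E (\<lambda>w. F (A w s) * ind w i s)) =
      real (card {1..m}) * E (\<lambda>w. F (A w s) * ind w k s)"
  proof (rule sum_permutation_invariant[OF _ assms])
    fix \<pi> i assume "\<pi> permutes {1..m}"
    from E_unit_permute[OF this, of "\<lambda>w. F (A w s) * ind w i s"]
    show "E (\<lambda>w. F (A w s) * ind w (\<pi> i) s) = E (\<lambda>w. F (A w s) * ind w i s)"
      by (simp add: group_size_unit_permute[OF \<open>\<pi> permutes {1..m}\<close>] ind_def)
  qed
  moreover have "(\<Sum>i\<in>{1..m}. E (\<lambda>w. F (A w s) * ind w i s)) = E (\<lambda>w. F (A w s) * A w s)"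
    by (simp add: group_size_def sum_distrib_left)
  ultimately show ?thesis
    using assms by (simp add: field_simps)
qed

lemma E_unit_sum:
  "E (\<lambda>w. F (A w s) * (\<Sum>k = 1..m. u k * ind w k s)) =
    (\<Sum>k = 1..m. u k) / m * E (\<lambda>w. F (A w s) * A w s)"
proof -
  have "E (\<lambda>w. F (A w s) * (\<Sum>k = 1..m. u k * ind w k s)) =
      (\<Sum>k = 1..m. u k * E (\<lambda>w. F (A w s) * ind w k s))"
    by (simp add: sum_distrib_left mult.left_commute)
  also have "\<dots> = (\<Sum>k = 1..m. u k * (E (\<lambda>w. F (A w s) * A w s) / m))"
    by (intro sum.cong refl) (simp add: E_unit)
  also have "\<dots> = (\<Sum>k = 1..m. u k) * (E (\<lambda>w. F (A w s) * A w s) / m)"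
    by (rule sum_distrib_right[symmetric])
  finally show ?thesis
    by simp
qed

text \<open>All \<open>m * (m - 1)\<close> ordered pairs of distinct units share one expectation, so
  the coefficients factor out. What remains is the same sum with unit coefficients. The form covers
  both \<open>s = t\<close> and \<open>s \<noteq> t\<close>.\<close>

lemma E_unit_pairs:
  "E (\<lambda>w. F (A w s) (A w t) *
      (\<Sum>k = 1..m. \<Sum>l\<in>{1..m} - {k}. (u k * ind w k s) * (v l * ind w l t))) =
    (\<Sum>k = 1..m. \<Sum>l\<in>{1..m} - {k}. u k * v l) / (real m * (real m - 1)) *
      E (\<lambda>w. F (A w s) (A w t) * (\<Sum>k = 1..m. \<Sum>l\<in>{1..m} - {k}. ind w k s * ind w l t))"
    (is "_ = _ * E ?G")
proof -
  define g where "g k l = E (\<lambda>w. F (A w s) (A w t) * (ind w k s * ind w l t))" for k l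
  have g: "(\<Sum>i\<in>{1..m}. \<Sum>j\<in>{1..m} - {i}. g i j) =
      real (card {1..m}) * (real (card {1..m}) - 1) * g k l"
    if "k \<in> {1..m}" "l \<in> {1..m}" "k \<noteq> l" for k l
  proof (rule sum_pairs_permutation_invariant[OF _ _ that])
    fix \<pi> i j assume "\<pi> permutes {1..m}"
    from E_unit_permute[OF this, of "\<lambda>w. F (A w s) (A w t) * (ind w i s * ind w j t)"]
    show "g (\<pi> i) (\<pi> j) = g i j"
      by (simp add: g_def group_size_unit_permute[OF \<open>\<pi> permutes {1..m}\<close>] ind_def)
  qed simp
  have G: "(\<Sum>i\<in>{1..m}. \<Sum>j\<in>{1..m} - {i}. g i j) = E ?G"
    by (simp add: g_def sum_distrib_left)
  have g': "g k l = E ?G / (real m * (real m - 1))"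
    if "k \<in> {1..m}" "l \<in> {1..m}" "k \<noteq> l" for k l
  proof -
    have "E ?G = real m * (real m - 1) * g k l"
      using g[OF that] unfolding G by simp
    moreover have "real m * (real m - 1) \<noteq> 0"
      using r_ge_2 m_ge by simp
    ultimately show ?thesis by simp
  qed
  have "E (\<lambda>w. F (A w s) (A w t) *
      (\<Sum>k = 1..m. \<Sum>l\<in>{1..m} - {k}. (u k * ind w k s) * (v l * ind w l t))) =
      (\<Sum>k = 1..m. \<Sum>l\<in>{1..m} - {k}. u k * v l * g k l)"
    by (simp add: g_def sum_distrib_left mult_ac)
  also have "\<dots> = (\<Sum>k = 1..m. \<Sum>l\<in>{1..m} - {k}. u k * v l * (E ?G / (real m * (real m - 1))))"
    using g' by (intro sum.cong refl) auto
  also have "\<dots> = (\<Sum>k = 1..m. \<Sum>l\<in>{1..m} - {k}. u k * v l) * (E ?G / (real m * (real m - 1)))"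
    by (simp only: sum_distrib_right)
  finally show ?thesis
    by simp
qed

text \<open>The case \<open>s = t\<close>: a group of size \<open>A w s\<close> contains
  \<open>A w s * (A w s - 1)\<close> ordered pairs of distinct units.\<close>

lemma E_square_sum:
  "E (\<lambda>w. F (A w s) * ((\<Sum>k = 1..m. u k * ind w k s)\<^sup>2 - (\<Sum>k = 1..m. (u k)\<^sup>2 * ind w k s))) =
    ((\<Sum>k = 1..m. u k)\<^sup>2 - (\<Sum>k = 1..m. (u k)\<^sup>2)) / (real m * (real m - 1)) *
      E (\<lambda>w. F (A w s) * (A w s * (A w s - 1)))"
proof -
  have "(\<Sum>k = 1..m. \<Sum>l\<in>{1..m} - {k}. ind w k s * ind w l s) = A w s * (A w s - 1)" for w
    by (simp add: sum_distinct_pairs group_size_def right_diff_distrib)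
  then show ?thesis
    using E_unit_pairs[of "\<lambda>x _. F x" s s u u]
    by (simp only: sum_pairs_same_group sum_distinct_pairs[of _ u u, OF finite_atLeastAtMost]
        power2_eq_square)
qed

text \<open>The case of two groups: they are disjoint, so there are \<open>A w s * A w t\<close>
  pairs.\<close>

lemma E_product_sum:
  assumes "s \<noteq> t"
  shows "E (\<lambda>w. F (A w s) (A w t) *
      ((\<Sum>k = 1..m. u k * ind w k s) * (\<Sum>k = 1..m. v k * ind w k t))) =
    ((\<Sum>k = 1..m. u k) * (\<Sum>k = 1..m. v k) - (\<Sum>k = 1..m. u k * v k)) / (real m * (real m - 1)) *
      E (\<lambda>w. F (A w s) (A w t) * (A w s * A w t))"
proof -
  have "(\<Sum>k = 1..m. \<Sum>l\<in>{1..m} - {k}. ind w k s * ind w l t) = A w s * A w t" for w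
    using sum_pairs_other_group[OF assms, where u = "\<lambda>_. 1" and v = "\<lambda>_. 1"]
    by (simp only: mult_1 group_size_def)
  then show ?thesis
    using E_unit_pairs[of F s t u v]
    by (simp only: sum_pairs_other_group[OF assms] sum_distinct_pairs[of _ u v, OF finite_atLeastAtMost])
qed

section \<open>Moments of group sizes\<close>

lemma sum_group_size:
  assumes "w \<in> balanced_assignments r m"
  shows "(\<Sum>s = 1..r. A w s) = m"
proof -
  have "(\<Sum>s = 1..r. A w s) = (\<Sum>k = 1..m. \<Sum>s = 1..r. ind w k s)"
    unfolding group_size_def by (rule sum.swap)
  also have "\<dots> = (\<Sum>k = 1..m. 1)"
    using assms unfolding balanced_assignments_def ind_def by (intro sum.cong) (auto simp: PiE_iff)
  finally show ?thesis by simp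
qed

lemma group_size_cases:
  assumes "w \<in> balanced_assignments r m" "s \<in> {1..r}"
  obtains "A w s = real (m div r)" | "A w s = real (m div r) + 1"
proof -
  have "A w s = real (m div r) \<or> A w s = real (m div r) + 1"
    using assms r_ge_2 by (simp add: balanced_assignments_iff del: One_nat_def)
  then show thesis
    using that by blast
qed

text \<open>The sizes add up to \<open>m\<close> and have equal expectations by symmetry of the
  treatments.\<close>

lemma E_group_size:
  assumes "s \<in> {1..r}"
  shows "E (\<lambda>w. A w s) = m / r"
proof -
  have "(\<Sum>i\<in>{1..r}. E (\<lambda>w. A w i)) = real (card {1..r}) * E (\<lambda>w. A w s)"
  proof (rule sum_permutation_invariant[OF _ assms])
    fix \<tau> i assume \<tau>: "\<tau> permutes {1..r}"
    from E_treatment_permute[OF \<tau>, of "\<lambda>w. A w (\<tau> i)"]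
    show "E (\<lambda>w. A w (\<tau> i)) = E (\<lambda>w. A w i)"
      by (simp only: group_size_treatment_permute[OF \<tau>])
  qed
  moreover have "(\<Sum>i\<in>{1..r}. E (\<lambda>w. A w i)) = m"
  proof -
    have "(\<Sum>i\<in>{1..r}. E (\<lambda>w. A w i)) = E (\<lambda>w. \<Sum>i\<in>{1..r}. A w i)"
      by simp
    also have "\<dots> = E (\<lambda>w. m)"
      by (rule E_cong) (rule sum_group_size)
    finally show ?thesis by simp
  qed
  ultimately show ?thesis
    using r_ge_2 by (simp add: field_simps)
qed

lemma real_mod: "real (m mod r) = real m - real r * real (m div r)"
  using mult_div_mod_eq[of r m] by (metis add_diff_cancel_left' of_nat_add of_nat_mult)

text \<open>A group size has only two values, on which any \<open>h\<close> agrees with an affine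
  function; the mean \<open>m / r\<close> therefore determines the expectation. In other words, the
  larger size has probability \<open>(m mod r) / r\<close>.\<close>

lemma E_fun_group_size:
  fixes h :: "real \<Rightarrow> real"
  assumes "s \<in> {1..r}"
  shows "E (\<lambda>w. h (A w s)) =
    ((real r - real (m mod r)) * h (real (m div r)) + real (m mod r) * h (real (m div r) + 1)) / r"
proof -
  let ?q = "real (m div r)"
  have "E (\<lambda>w. h (A w s)) = E (\<lambda>w. h ?q + (h (?q + 1) - h ?q) * (A w s - ?q))"
  proof (rule E_cong)
    fix w assume "w \<in> balanced_assignments r m"
    from group_size_cases[OF this assms]
    show "h (A w s) = h ?q + (h (?q + 1) - h ?q) * (A w s - ?q)" by cases auto
  qed
  also have "\<dots> = h ?q + (h (?q + 1) - h ?q) * (m / r - ?q)"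
    by (simp add: E_group_size[OF assms])
  also have "m / r - ?q = real (m mod r) / r"
    using r_ge_2 by (simp add: real_mod field_simps)
  also have "h ?q + (h (?q + 1) - h ?q) * (real (m mod r) / r) =
      ((real r - real (m mod r)) * h ?q + real (m mod r) * h (?q + 1)) / r"
    using r_ge_2 by (simp add: field_simps)
  finally show ?thesis .
qed

text \<open>The source of a denominator in \<open>sigma2_HT\<close>, which is \<open>m\<close> times
  the numerator found here.\<close>

lemma E_group_size_falling:
  assumes "s \<in> {1..r}"
  shows "E (\<lambda>w. A w s * (A w s - 1)) =
    (real m * (real m - real r) + real (m mod r) * (real r - real (m mod r))) / (real r)\<^sup>2"
  unfolding E_fun_group_size[OF assms, of "\<lambda>x. x * (x - 1)"] real_mod
  using r_ge_2 by (simp add: field_simps power2_eq_square)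

text \<open>The squared total of the group sizes is the constant \<open>m^2\<close>. Subtracting the
  second moments leaves the products over distinct treatments, and symmetry gives each of the
  \<open>r * (r - 1)\<close> ordered pairs an equal share.\<close>

lemma E_group_size_product:
  assumes st: "s \<in> {1..r}" "t \<in> {1..r}" "s \<noteq> t"
  shows "E (\<lambda>w. A w s * A w t) =
    ((real r - 1) * (real m)\<^sup>2 - real (m mod r) * (real r - real (m mod r))) /
      ((real r)\<^sup>2 * (real r - 1))"
proof -
  have "(\<Sum>i\<in>{1..r}. \<Sum>j\<in>{1..r} - {i}. E (\<lambda>w. A w i * A w j)) =
      real (card {1..r}) * (real (card {1..r}) - 1) * E (\<lambda>w. A w s * A w t)"
  proof (rule sum_pairs_permutation_invariant[OF _ _ st])
    fix \<tau> i j assume \<tau>: "\<tau> permutes {1..r}"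
    from E_treatment_permute[OF \<tau>, of "\<lambda>w. A w (\<tau> i) * A w (\<tau> j)"]
    show "E (\<lambda>w. A w (\<tau> i) * A w (\<tau> j)) = E (\<lambda>w. A w i * A w j)"
      by (simp only: group_size_treatment_permute[OF \<tau>])
  qed simp
  moreover have "(\<Sum>i\<in>{1..r}. \<Sum>j\<in>{1..r} - {i}. E (\<lambda>w. A w i * A w j)) =
      (real m)\<^sup>2 - (\<Sum>i\<in>{1..r}. E (\<lambda>w. (A w i)\<^sup>2))"
  proof -
    have "(\<Sum>i\<in>{1..r}. \<Sum>j\<in>{1..r} - {i}. E (\<lambda>w. A w i * A w j)) =
        E (\<lambda>w. \<Sum>i\<in>{1..r}. \<Sum>j\<in>{1..r} - {i}. A w i * A w j)"
      by simp
    also have "\<dots> = E (\<lambda>w. (real m)\<^sup>2 - (\<Sum>i\<in>{1..r}. (A w i)\<^sup>2))"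
      by (rule E_cong) (simp add: sum_distinct_pairs sum_group_size power2_eq_square del: One_nat_def)
    finally show ?thesis by simp
  qed
  moreover have "(\<Sum>i\<in>{1..r}. E (\<lambda>w. (A w i)\<^sup>2)) =
      (real r - real (m mod r)) * (real (m div r))\<^sup>2 + real (m mod r) * (real (m div r) + 1)\<^sup>2"
    using r_ge_2 by (simp add: E_fun_group_size[of _ "\<lambda>x. x\<^sup>2"])
  ultimately have *: "real r * (real r - 1) * E (\<lambda>w. A w s * A w t) = (real m)\<^sup>2 -
      ((real r - real (m mod r)) * (real (m div r))\<^sup>2 + real (m mod r) * (real (m div r) + 1)\<^sup>2)"
    by simp
  have "real r * (real r - 1) \<noteq> 0"
    using r_ge_2 by simp
  then have "E (\<lambda>w. A w s * A w t) = ((real m)\<^sup>2 -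
      ((real r - real (m mod r)) * (real (m div r))\<^sup>2 + real (m mod r) * (real (m div r) + 1)\<^sup>2))
        / (real r * (real r - 1))"
    using * by (simp add: field_simps)
  \<comment> \<open>Expanding by \<open>r\<close> lets \<open>m div r\<close> disappear from the
    numerator once \<open>m mod r\<close> is written as \<open>m - r * (m div r)\<close>.\<close>
  also have "\<dots> = real r * ((real m)\<^sup>2 -
      ((real r - real (m mod r)) * (real (m div r))\<^sup>2 + real (m mod r) * (real (m div r) + 1)\<^sup>2))
        / ((real r)\<^sup>2 * (real r - 1))"
    using r_ge_2 by (simp add: power2_eq_square)
  also have "real r * ((real m)\<^sup>2 -
      ((real r - real (m mod r)) * (real (m div r))\<^sup>2 + real (m mod r) * (real (m div r) + 1)\<^sup>2)) =
      (real r - 1) * (real m)\<^sup>2 - real (m mod r) * (real r - real (m mod r))"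
    unfolding real_mod by algebra
  finally show ?thesis .
qed

end

subsection \<open>Bias of the variance estimators in one block\<close>

text \<open>The divisor is \<open>m\<close> rather than \<open>m - 1\<close>, to match the factor
  \<open>(m - 1) / m\<close> in the sample estimator.\<close>

definition pop_var :: "nat \<Rightarrow> (nat \<Rightarrow> real) \<Rightarrow> real" where
  "pop_var m u = (\<Sum>k = 1..m. (u k - (\<Sum>l = 1..m. u l) / m)\<^sup>2) / m"

lemma pop_var_eq:
  "pop_var m u = (\<Sum>k = 1..m. (u k)\<^sup>2) / m - ((\<Sum>k = 1..m. u k) / m)\<^sup>2"
proof (cases "m = 0")
  case False
  define a where "a = (\<Sum>k = 1..m. u k)"
  have "(\<Sum>k = 1..m. (u k - a / m)\<^sup>2) = (\<Sum>k = 1..m. (u k)\<^sup>2 - 2 * (a / m) * u k + (a / m)\<^sup>2)"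
    by (intro sum.cong) (simp_all add: power2_diff)
  also have "\<dots> = (\<Sum>k = 1..m. (u k)\<^sup>2) - 2 * (a / m) * a + m * (a / m)\<^sup>2"
    unfolding sum.distrib sum_subtractf sum_distrib_left[symmetric] a_def by simp
  finally have "pop_var m u = ((\<Sum>k = 1..m. (u k)\<^sup>2) - 2 * (a / m) * a + m * (a / m)\<^sup>2) / m"
    unfolding pop_var_def a_def by (simp only:)
  then show ?thesis
    unfolding a_def[symmetric] using False by (simp add: field_simps power2_eq_square)
qed (simp add: pop_var_def)

text \<open>The shape in which the algebraic bias identities deliver their result, up to the divisor
  \<open>m - 1\<close>.\<close>

lemma pop_var_diff:
  "pop_var m (\<lambda>k. u k - v k) =
    ((\<Sum>k = 1..m. (u k)\<^sup>2) - 2 * (\<Sum>k = 1..m. u k * v k) + (\<Sum>k = 1..m. (v k)\<^sup>2)) / m -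
      ((\<Sum>k = 1..m. u k) / m - (\<Sum>k = 1..m. v k) / m)\<^sup>2"
  unfolding pop_var_eq
  by (simp add: power2_diff sum.distrib sum_subtractf sum_distrib_left[symmetric] add_divide_distrib
      diff_divide_distrib mult.assoc)

lemma pop_var_nonneg: "0 \<le> pop_var m u"
  by (simp add: pop_var_def sum_nonneg)

text \<open>A sum of squares vanishes only if every deviation from the mean does; for
  \<open>m = 0\<close> both sides hold.\<close>

lemma pop_var_eq_0_iff: "pop_var m u = 0 \<longleftrightarrow> (\<exists>a. \<forall>k\<in>{1..m}. u k = a)"
proof (cases "m = 0")
  case False
  have "pop_var m u = 0 \<longleftrightarrow> (\<forall>k\<in>{1..m}. u k = (\<Sum>l = 1..m. u l) / m)"
    using False by (simp add: pop_var_def sum_nonneg_eq_0_iff)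
  moreover have "(\<Sum>l = 1..m. u l) / m = a" if "\<forall>k\<in>{1..m}. u k = a" for a
    using that False by simp
  ultimately show ?thesis by metis
qed (simp add: pop_var_def)

section \<open>Estimators restricted to one block\<close>

text \<open>Here and below \<open>u\<close> and \<open>v\<close> are the outcomes under
  \<open>s\<close> and \<open>t\<close>. The weights of the block are left out and return when the
  blocks are combined.\<close>

definition block_diff ::
    "nat \<Rightarrow> (nat \<Rightarrow> real) \<Rightarrow> (nat \<Rightarrow> real) \<Rightarrow> nat \<Rightarrow> nat \<Rightarrow> (nat \<Rightarrow> nat) \<Rightarrow> real" where
  "block_diff m u v s t w =
     (\<Sum>k = 1..m. u k * ind w k s / group_size m w s - v k * ind w k t / group_size m w t)"

definition block_HT ::
    "nat \<Rightarrow> nat \<Rightarrow> (nat \<Rightarrow> real) \<Rightarrow> (nat \<Rightarrow> real) \<Rightarrow> nat \<Rightarrow> nat \<Rightarrow> (nat \<Rightarrow> nat) \<Rightarrow> real" where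
  "block_HT r m u v s t w =
     (\<Sum>k = 1..m. u k * ind w k s / (real m / real r) - v k * ind w k t / (real m / real r))"

definition block_samp :: "nat \<Rightarrow> (nat \<Rightarrow> real) \<Rightarrow> nat \<Rightarrow> (nat \<Rightarrow> nat) \<Rightarrow> real" where
  "block_samp m u s w = (real m - 1) / real m *
     (\<Sum>k = 1..m. ind w k s * (u k - (\<Sum>l = 1..m. u l * ind w l s / group_size m w s))\<^sup>2 /
        (group_size m w s - 1))"

definition block_sigma2_HT :: "nat \<Rightarrow> nat \<Rightarrow> (nat \<Rightarrow> real) \<Rightarrow> nat \<Rightarrow> (nat \<Rightarrow> nat) \<Rightarrow> real" where
  "block_sigma2_HT r m u s w =
     (let nc = real m; \<rho> = real r; z = real (m mod r) in
        (nc - 1) * \<rho> / nc\<^sup>2 * (\<Sum>k = 1..m. (u k)\<^sup>2 * ind w k s)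
        - (nc - 1) * \<rho>\<^sup>2 / (nc\<^sup>2 * (nc - \<rho>) + nc * z * (\<rho> - z)) *
          (\<Sum>k = 1..m. \<Sum>l \<in> {1..m} - {k}. u k * u l * ind w k s * ind w l s))"

definition block_var_diff ::
    "nat \<Rightarrow> nat \<Rightarrow> (nat \<Rightarrow> real) \<Rightarrow> (nat \<Rightarrow> real) \<Rightarrow> nat \<Rightarrow> nat \<Rightarrow> (nat \<Rightarrow> nat) \<Rightarrow> real" where
  "block_var_diff r m u v s t w =
     (let nc = real m; \<rho> = real r; z = real (m mod r) in
       (\<rho> / (nc - 1) + \<rho> * z * (\<rho> - z) / ((nc - 1) * (nc - z) * (nc + \<rho> - z))) *
         (block_samp m u s w + block_samp m v t w))"

definition block_var_HT ::
    "nat \<Rightarrow> nat \<Rightarrow> (nat \<Rightarrow> real) \<Rightarrow> (nat \<Rightarrow> real) \<Rightarrow> nat \<Rightarrow> nat \<Rightarrow> (nat \<Rightarrow> nat) \<Rightarrow> real" where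
  "block_var_HT r m u v s t w =
     (let nc = real m; \<rho> = real r; z = real (m mod r) in
       \<rho> / (nc - 1) * (block_sigma2_HT r m u s w + block_sigma2_HT r m v t w)
       + \<rho>\<^sup>2 * z * (\<rho> - z) / (nc ^ 3 * (nc - \<rho>) + nc\<^sup>2 * z * (\<rho> - z)) *
         (\<Sum>k = 1..m. \<Sum>l \<in> {1..m} - {k}.
            u k * u l * ind w k s * ind w l s + v k * v l * ind w k t * ind w l t)
       + 2 * \<rho>\<^sup>2 * z * (\<rho> - z) / (nc ^ 4 * (\<rho> - 1) - nc\<^sup>2 * z * (\<rho> - z)) *
         (\<Sum>k = 1..m. \<Sum>l \<in> {1..m} - {k}. u k * v l * ind w k s * ind w l t))"

section \<open>Bias for the difference in means\<close>

text \<open>\<open>a\<close> and \<open>b\<close> are the totals of \<open>u\<close> and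
  \<open>v\<close>, \<open>a2\<close> and \<open>b2\<close> the totals of their squares,
  \<open>ab\<close> that of their products, and \<open>e\<close> is the expected inverse group size.
  The expected estimate minus the variance is on the left; all terms in \<open>e\<close>
  cancel.\<close>

lemma diff_bias_identity:
  fixes m e a b a2 b2 ab :: real
  assumes "m > 1"
  shows "m * e / (m - 1) * (a2 / m - (a / m)\<^sup>2 + (b2 / m - (b / m)\<^sup>2))
      - ((a\<^sup>2 - a2) / (m * (m - 1)) * (1 - e) + a2 / m * e
          + ((b\<^sup>2 - b2) / (m * (m - 1)) * (1 - e) + b2 / m * e)
          - 2 * ((a * b - ab) / (m * (m - 1))) - (a / m - b / m)\<^sup>2) =
    ((a2 - 2 * ab + b2) / m - (a / m - b / m)\<^sup>2) / (m - 1)"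
  using assms by (simp add: divide_simps) algebra

context balanced_block
begin

lemma quotient_ge_2: "2 \<le> m div r"
  using r_ge_2 m_ge by (metis div_le_mono nonzero_mult_div_cancel_right not_numeral_le_zero)

lemma group_size_ge_2:
  assumes "w \<in> balanced_assignments r m" "s \<in> {1..r}"
  shows "2 \<le> A w s"
proof -
  have "2 \<le> real (m div r)"
    using quotient_ge_2 by simp
  with group_size_cases[OF assms] show ?thesis by force
qed

lemma E_variance: "measure_pmf.variance assignment_pmf f = E (\<lambda>w. (f w)\<^sup>2) - (E f)\<^sup>2"
  by (rule prob_space.variance_eq[OF prob_space_measure_pmf]) simp_all

lemma E_mean_group:
  assumes "s \<in> {1..r}"
  shows "E (\<lambda>w. (\<Sum>k = 1..m. u k * ind w k s) / A w s) = (\<Sum>k = 1..m. u k) / m"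
proof -
  have "E (\<lambda>w. inverse (A w s) * A w s) = E (\<lambda>w. 1)"
    using group_size_ge_2[OF _ assms] by (intro E_cong) force
  then show ?thesis
    using E_unit_sum[of inverse s u] by (simp add: divide_inverse mult.commute)
qed

text \<open>The square is split into distinct pairs and the diagonal. Weighted by the inverse
  squared group size, their counts become \<open>1 - 1 / A w s\<close> and
  \<open>1 / A w s\<close>.\<close>

lemma E_square_mean_group:
  assumes "s \<in> {1..r}"
  shows "E (\<lambda>w. ((\<Sum>k = 1..m. u k * ind w k s) / A w s)\<^sup>2) =
    ((\<Sum>k = 1..m. u k)\<^sup>2 - (\<Sum>k = 1..m. (u k)\<^sup>2)) / (real m * (real m - 1)) *
      (1 - E (\<lambda>w. 1 / A w s)) + (\<Sum>k = 1..m. (u k)\<^sup>2) / m * E (\<lambda>w. 1 / A w s)"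
proof -
  let ?U = "\<lambda>w. \<Sum>k = 1..m. u k * ind w k s" and ?U2 = "\<lambda>w. \<Sum>k = 1..m. (u k)\<^sup>2 * ind w k s"
  let ?F = "\<lambda>x::real. 1 / x\<^sup>2"
  have "E (\<lambda>w. (?U w / A w s)\<^sup>2) =
      E (\<lambda>w. ?F (A w s) * ((?U w)\<^sup>2 - ?U2 w) + ?F (A w s) * ?U2 w)"
    by (rule E_cong) (simp add: power_divide diff_divide_distrib del: One_nat_def)
  also have "\<dots> = E (\<lambda>w. ?F (A w s) * ((?U w)\<^sup>2 - ?U2 w)) + E (\<lambda>w. ?F (A w s) * ?U2 w)"
    by (rule Bochner_Integration.integral_add) auto
  also have "E (\<lambda>w. ?F (A w s) * (A w s * (A w s - 1))) = E (\<lambda>w. 1 - 1 / A w s)"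
    using group_size_ge_2[OF _ assms] by (intro E_cong) (force simp: field_simps power2_eq_square)
  then have "E (\<lambda>w. ?F (A w s) * ((?U w)\<^sup>2 - ?U2 w)) =
      ((\<Sum>k = 1..m. u k)\<^sup>2 - (\<Sum>k = 1..m. (u k)\<^sup>2)) / (real m * (real m - 1)) *
      (1 - E (\<lambda>w. 1 / A w s))"
    using E_square_sum[of ?F s u] by (simp del: One_nat_def)
  also have "E (\<lambda>w. ?F (A w s) * A w s) = E (\<lambda>w. 1 / A w s)"
    by (intro E_cong) (simp add: power2_eq_square)
  then have "E (\<lambda>w. ?F (A w s) * ?U2 w) = (\<Sum>k = 1..m. (u k)\<^sup>2) / m * E (\<lambda>w. 1 / A w s)"
    using E_unit_sum[of ?F s "\<lambda>k. (u k)\<^sup>2"] by (simp only:)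
  finally show ?thesis .
qed

text \<open>The weight cancels the number of pairs exactly, so no moment of group sizes is
  left.\<close>

lemma E_product_mean_group:
  assumes "s \<in> {1..r}" "t \<in> {1..r}" "s \<noteq> t"
  shows "E (\<lambda>w. (\<Sum>k = 1..m. u k * ind w k s) / A w s * ((\<Sum>k = 1..m. v k * ind w k t) / A w t)) =
    ((\<Sum>k = 1..m. u k) * (\<Sum>k = 1..m. v k) - (\<Sum>k = 1..m. u k * v k)) / (real m * (real m - 1))"
proof -
  have "E (\<lambda>w. 1 / (A w s * A w t) * (A w s * A w t)) = E (\<lambda>w. 1)"
    using group_size_ge_2[OF _ assms(1)] group_size_ge_2[OF _ assms(2)] by (intro E_cong) force
  then show ?thesis
    using E_product_sum[OF assms(3), of "\<lambda>x y. 1 / (x * y)" u v] by simp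
qed

text \<open>Expanding around the group mean leaves a sum over units divided by their number and a
  sum over pairs divided by theirs. Each weight cancels its count, hence unbiasedness for random
  group sizes.\<close>

lemma E_block_samp:
  assumes "s \<in> {1..r}"
  shows "E (block_samp m u s) = pop_var m u"
proof -
  let ?U = "\<lambda>w. \<Sum>k = 1..m. u k * ind w k s" and ?U2 = "\<lambda>w. \<Sum>k = 1..m. (u k)\<^sup>2 * ind w k s"
  let ?F = "\<lambda>x::real. 1 / (x * (x - 1))"
  have pt: "block_samp m u s w = (real m - 1) / real m *
      (1 / A w s * ?U2 w - ?F (A w s) * ((?U w)\<^sup>2 - ?U2 w))"
    if w: "w \<in> balanced_assignments r m" for w
  proof -
    define c where "c = ?U w / A w s"
    have A: "A w s > 1"
      using group_size_ge_2[OF w assms] by simp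
    have "(\<Sum>k = 1..m. ind w k s * (u k - c)\<^sup>2) =
        (\<Sum>k = 1..m. (u k)\<^sup>2 * ind w k s - 2 * c * (u k * ind w k s) + c\<^sup>2 * ind w k s)"
      by (intro sum.cong) (simp_all add: power2_diff algebra_simps)
    also have "\<dots> = ?U2 w - 2 * c * ?U w + c\<^sup>2 * A w s"
      by (simp add: sum.distrib sum_subtractf sum_distrib_left[symmetric] group_size_def
          del: One_nat_def)
    finally have "block_samp m u s w =
        (real m - 1) / real m * ((?U2 w - 2 * c * ?U w + c\<^sup>2 * A w s) / (A w s - 1))"
      by (simp add: block_samp_def c_def sum_divide_distrib[symmetric] del: One_nat_def)
    also have "(?U2 w - 2 * c * ?U w + c\<^sup>2 * A w s) / (A w s - 1) =
        1 / A w s * ?U2 w - ?F (A w s) * ((?U w)\<^sup>2 - ?U2 w)"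
      using A by (simp add: c_def field_simps power2_eq_square del: One_nat_def)
    finally show ?thesis .
  qed
  have "E (\<lambda>w. 1 / A w s * A w s) = E (\<lambda>w. 1)"
    using group_size_ge_2[OF _ assms] by (intro E_cong) force
  then have 1: "E (\<lambda>w. 1 / A w s * ?U2 w) = (\<Sum>k = 1..m. (u k)\<^sup>2) / m"
    using E_unit_sum[of "\<lambda>x. 1 / x" s "\<lambda>k. (u k)\<^sup>2"] by (simp del: One_nat_def)
  have "E (\<lambda>w. ?F (A w s) * (A w s * (A w s - 1))) = E (\<lambda>w. 1)"
    using group_size_ge_2[OF _ assms] by (intro E_cong) force
  then have 2: "E (\<lambda>w. ?F (A w s) * ((?U w)\<^sup>2 - ?U2 w)) =
      ((\<Sum>k = 1..m. u k)\<^sup>2 - (\<Sum>k = 1..m. (u k)\<^sup>2)) / (real m * (real m - 1))"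
    using E_square_sum[of ?F s u] by (simp del: One_nat_def)
  have "E (block_samp m u s) = E (\<lambda>w. (real m - 1) / real m *
      (1 / A w s * ?U2 w - ?F (A w s) * ((?U w)\<^sup>2 - ?U2 w)))"
    by (rule E_cong) (rule pt)
  also have "\<dots> = (real m - 1) / real m *
      (E (\<lambda>w. 1 / A w s * ?U2 w) - E (\<lambda>w. ?F (A w s) * ((?U w)\<^sup>2 - ?U2 w)))"
    by (simp only: integral_mult_right_zero Bochner_Integration.integral_diff integrable_assignment)
  also have "\<dots> = pop_var m u"
    unfolding 1 2 pop_var_eq using r_ge_2 m_ge by (simp add: field_simps power2_eq_square del: One_nat_def)
  finally show ?thesis .
qed

text \<open>Explains the coefficient in \<open>var_est_diff\<close>: it is
  \<open>m / (m - 1)\<close> times the expected inverse group size. With \<open>q = m div r\<close>,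
  its factors \<open>m - z\<close> and \<open>m + r - z\<close> are \<open>r * q\<close> and
  \<open>r * (q + 1)\<close>.\<close>

lemma E_inverse_group_size:
  assumes "s \<in> {1..r}"
  shows "real m * E (\<lambda>w. 1 / A w s) / (real m - 1) =
    real r / (real m - 1) + real r * real (m mod r) * (real r - real (m mod r)) /
      ((real m - 1) * (real m - real (m mod r)) * (real m + real r - real (m mod r)))"
proof -
  define q where "q = real (m div r)"
  define z where "z = real (m mod r)"
  have m: "real m = real r * q + z"
    using real_mod by (simp add: q_def z_def)
  have q: "q > 0"
    using quotient_ge_2 by (simp add: q_def)
  have e: "E (\<lambda>w. 1 / A w s) = ((real r - z) / q + z / (q + 1)) / r"
    using E_fun_group_size[OF assms, of "\<lambda>x. 1 / x"] by (simp add: q_def z_def)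
  have d: "real m - z = real r * q" "real m + real r - z = real r * (q + 1)"
    by (simp_all add: m algebra_simps)
  have "real m * E (\<lambda>w. 1 / A w s) = r + r * z * (r - z) / ((real r * q) * (real r * (q + 1)))"
    unfolding e m using q r_ge_2 by (simp add: divide_simps) algebra
  then show ?thesis
    unfolding z_def[symmetric] mult.assoc[of "real m - 1"] d
    by (simp add: add_divide_distrib mult_ac)
qed

lemma block_diff_bias:
  assumes st: "s \<in> {1..r}" "t \<in> {1..r}" "s \<noteq> t"
  shows "E (block_var_diff r m u v s t) - measure_pmf.variance assignment_pmf (block_diff m u v s t) =
    pop_var m (\<lambda>k. u k - v k) / (real m - 1)"
proof -
  define e where "e = E (\<lambda>w. 1 / A w s)"
  \<comment> \<open>Group sizes have the same law for all treatments, so one constant serves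
    both.\<close>
  have et: "E (\<lambda>w. 1 / A w t) = e"
    unfolding e_def E_fun_group_size[OF st(1), of "\<lambda>x. 1 / x"]
      E_fun_group_size[OF st(2), of "\<lambda>x. 1 / x"] ..
  have "E (block_var_diff r m u v s t) = real m * e / (real m - 1) * (pop_var m u + pop_var m v)"
    unfolding e_def E_inverse_group_size[OF st(1)]
    by (simp add: block_var_diff_def[abs_def] Let_def E_block_samp[OF st(1)]
        E_block_samp[OF st(2)] del: One_nat_def)
  moreover have "block_diff m u v s t w = (\<Sum>k = 1..m. u k * ind w k s) / A w s -
      (\<Sum>k = 1..m. v k * ind w k t) / A w t" for w
    by (simp add: block_diff_def sum_subtractf sum_divide_distrib)
  moreover have "E (\<lambda>w. ((\<Sum>k = 1..m. u k * ind w k s) / A w s -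
      (\<Sum>k = 1..m. v k * ind w k t) / A w t)\<^sup>2) =
      E (\<lambda>w. ((\<Sum>k = 1..m. u k * ind w k s) / A w s)\<^sup>2) +
      E (\<lambda>w. ((\<Sum>k = 1..m. v k * ind w k t) / A w t)\<^sup>2) -
      2 * E (\<lambda>w. (\<Sum>k = 1..m. u k * ind w k s) / A w s * ((\<Sum>k = 1..m. v k * ind w k t) / A w t))"
    unfolding power2_diff mult.assoc
    by (simp only: integral_mult_right_zero Bochner_Integration.integral_diff
        Bochner_Integration.integral_add integrable_assignment)
  moreover have "E (\<lambda>w. (\<Sum>k = 1..m. u k * ind w k s) / A w s -
      (\<Sum>k = 1..m. v k * ind w k t) / A w t) = (\<Sum>k = 1..m. u k) / m - (\<Sum>k = 1..m. v k) / m"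
    by (simp only: Bochner_Integration.integral_diff integrable_assignment E_mean_group st)
  moreover have "real m > 1"
    using r_ge_2 m_ge by simp
  ultimately show ?thesis
    unfolding E_variance pop_var_diff pop_var_eq
    by (simp only: E_square_mean_group[OF st(1)] E_square_mean_group[OF st(2)] et e_def[symmetric]
        E_product_mean_group[OF st] diff_bias_identity)
qed

end

section \<open>Bias for the Horvitz-Thompson estimator\<close>

text \<open>\<open>W\<close> stands for \<open>z * (r - z)\<close>, and \<open>X\<close> and
  \<open>Y\<close> are the numerators of the second-order moments of group sizes. \<open>S\<close>
  and \<open>C\<close> are the expected sums over pairs within one group and across two groups, and
  \<open>V\<close> is the expectation of \<open>sigma2_HT\<close>.\<close>

lemma HT_bias_identity:
  fixes m r W X Y a b a2 b2 ab :: real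
  assumes "m > 1" "r > 1" "X = m * (m - r) + W" "Y = (r - 1) * m\<^sup>2 - W" "X \<noteq> 0" "Y \<noteq> 0"
  defines "S \<equiv> \<lambda>a a2. (a\<^sup>2 - a2) / (m * (m - 1)) * (X / r\<^sup>2)"
    and "C \<equiv> (a * b - ab) / (m * (m - 1)) * (Y / (r\<^sup>2 * (r - 1)))"
  defines "V \<equiv> \<lambda>a a2. (m - 1) * r / m\<^sup>2 * (a2 / r) - (m - 1) * r\<^sup>2 / (m * X) * S a a2"
  shows "r / (m - 1) * (V a a2 + V b b2) + r\<^sup>2 * W / (m\<^sup>2 * X) * (S a a2 + S b b2)
      + 2 * r\<^sup>2 * W / (m\<^sup>2 * Y) * C
      - ((r / m)\<^sup>2 * (S a a2 + a2 / r + (S b b2 + b2 / r) - 2 * C) - (r / m * (a / r - b / r))\<^sup>2) =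
    ((a2 - 2 * ab + b2) / m - (a / m - b / m)\<^sup>2) / (m - 1)"
proof -
  \<comment> \<open>\<open>X\<close> cancels, so \<open>V\<close> is the population
    variance.\<close>
  have V: "V a a2 = a2 / m - (a / m)\<^sup>2" for a a2
    using assms(1,2,5) unfolding V_def S_def by (simp add: divide_simps) algebra
  \<comment> \<open>The two correction terms of the estimator equal the contributions of
    \<open>W\<close> to the variance, found in \<open>sq\<close> and \<open>cross\<close>, and so
    cancel them.\<close>
  have S: "r\<^sup>2 * W / (m\<^sup>2 * X) * S a a2 = W * (a\<^sup>2 - a2) / (m ^ 3 * (m - 1))" for a a2
    using assms(1,2,5) unfolding S_def by (simp add: divide_simps) algebra
  have C: "2 * r\<^sup>2 * W / (m\<^sup>2 * Y) * C = 2 * W * (a * b - ab) / ((r - 1) * m ^ 3 * (m - 1))"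
    using assms(1,2,6) unfolding C_def by (simp add: divide_simps) algebra
  have sq: "(r / m)\<^sup>2 * (S a a2 + a2 / r) = (r - 1) / (m - 1) * (a2 / m - (a / m)\<^sup>2) +
      W * (a\<^sup>2 - a2) / (m ^ 3 * (m - 1)) + (a / m)\<^sup>2" for a a2
    using assms(1,2) unfolding S_def assms(3) by (simp add: divide_simps) algebra
  have cross: "(r / m)\<^sup>2 * (2 * C) = 2 * (a * b - ab) / (m * (m - 1)) -
      2 * W * (a * b - ab) / ((r - 1) * m ^ 3 * (m - 1))"
    using assms(1,2) unfolding C_def assms(4) by (simp add: divide_simps) algebra
  have mean: "r / m * (a / r - b / r) = a / m - b / m"
    using assms(1,2) by (simp add: field_simps)
  \<comment> \<open>Population variances enter the estimate with factor \<open>r / (m - 1)\<close>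
    but the variance with \<open>(r - 1) / (m - 1)\<close>; this surplus supplies the squares in the
    bias.\<close>
  have rest: "r / (m - 1) * (\<sigma> + \<tau>) - (r - 1) / (m - 1) * \<sigma> - (r - 1) / (m - 1) * \<tau> =
      (\<sigma> + \<tau>) / (m - 1)" for \<sigma> \<tau>
    using assms(1) by (simp add: divide_simps) algebra
  have "((a2 / m - (a / m)\<^sup>2) + (b2 / m - (b / m)\<^sup>2)) / (m - 1) - (a / m)\<^sup>2 - (b / m)\<^sup>2
      + 2 * (a * b - ab) / (m * (m - 1)) + (a / m - b / m)\<^sup>2 =
    ((a2 - 2 * ab + b2) / m - (a / m - b / m)\<^sup>2) / (m - 1)"
    using assms(1) by (simp add: divide_simps) algebra
  then show ?thesis
    unfolding V C mean distrib_left[of "r\<^sup>2 * W / (m\<^sup>2 * X)"] S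
      right_diff_distrib[of "(r / m)\<^sup>2"] distrib_left[of "(r / m)\<^sup>2"] sq[unfolded distrib_left] cross
    using rest[of "a2 / m - (a / m)\<^sup>2" "b2 / m - (b / m)\<^sup>2"] by linarith
qed

context balanced_block
begin

lemma E_sum_pairs_same:
  assumes "s \<in> {1..r}"
  shows "E (\<lambda>w. \<Sum>k = 1..m. \<Sum>l\<in>{1..m} - {k}. u k * u l * ind w k s * ind w l s) =
    ((\<Sum>k = 1..m. u k)\<^sup>2 - (\<Sum>k = 1..m. (u k)\<^sup>2)) / (real m * (real m - 1)) *
    ((real m * (real m - real r) + real (m mod r) * (real r - real (m mod r))) / (real r)\<^sup>2)"
proof -
  have "(\<Sum>k = 1..m. \<Sum>l\<in>{1..m} - {k}. u k * u l * ind w k s * ind w l s) =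
      (\<Sum>k = 1..m. u k * ind w k s)\<^sup>2 - (\<Sum>k = 1..m. (u k)\<^sup>2 * ind w k s)" for w
    unfolding sum_pairs_same_group[symmetric] by (simp add: mult_ac)
  then show ?thesis
    using E_square_sum[of "\<lambda>_. 1" s u] E_group_size_falling[OF assms] by (simp only: mult_1)
qed

lemma E_sum_pairs_other:
  assumes "s \<in> {1..r}" "t \<in> {1..r}" "s \<noteq> t"
  shows "E (\<lambda>w. \<Sum>k = 1..m. \<Sum>l\<in>{1..m} - {k}. u k * v l * ind w k s * ind w l t) =
    ((\<Sum>k = 1..m. u k) * (\<Sum>k = 1..m. v k) - (\<Sum>k = 1..m. u k * v k)) / (real m * (real m - 1)) *
    (((real r - 1) * (real m)\<^sup>2 - real (m mod r) * (real r - real (m mod r))) /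
      ((real r)\<^sup>2 * (real r - 1)))"
proof -
  have "(\<Sum>k = 1..m. \<Sum>l\<in>{1..m} - {k}. u k * v l * ind w k s * ind w l t) =
      (\<Sum>k = 1..m. u k * ind w k s) * (\<Sum>k = 1..m. v k * ind w k t)" for w
    unfolding sum_pairs_other_group[OF assms(3), symmetric] by (simp add: mult_ac)
  then show ?thesis
    using E_product_sum[OF assms(3), of "\<lambda>_ _. 1" u v] E_group_size_product[OF assms]
    by (simp only: mult_1)
qed

lemma E_sum_group:
  assumes "s \<in> {1..r}"
  shows "E (\<lambda>w. \<Sum>k = 1..m. u k * ind w k s) = (\<Sum>k = 1..m. u k) / r"
  using E_unit_sum[of "\<lambda>_. 1" s u] E_group_size[OF assms] r_ge_2 m_ge by simp

text \<open>The normalization \<open>m / r\<close> is constant, so the mean and second-order moments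
  of group sizes suffice, and the claim reduces to \<open>HT_bias_identity\<close>.\<close>

lemma block_HT_bias:
  assumes st: "s \<in> {1..r}" "t \<in> {1..r}" "s \<noteq> t"
  shows "E (block_var_HT r m u v s t) - measure_pmf.variance assignment_pmf (block_HT r m u v s t) =
    pop_var m (\<lambda>k. u k - v k) / (real m - 1)"
proof -
  define z where "z = real (m mod r)"
  define W where "W = z * (real r - z)"
  define X where "X = real m * (real m - real r) + W"
  define Y where "Y = (real r - 1) * (real m)\<^sup>2 - W"
  have z: "0 \<le> z" "z < r"
    using r_ge_2 by (simp_all add: z_def)
  have mr: "real m > 1" "real r > 1" "2 * real r \<le> real m"
    using r_ge_2 m_ge by simp_all
  have W: "0 \<le> W"
    using z by (simp add: W_def)
  \<comment> \<open>\<open>X\<close> and \<open>Y\<close> are divisors in the estimator; they are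
    nonzero because \<open>m > r\<close> and \<open>W \<le> r^2 < m^2\<close>.\<close>
  have X: "X \<noteq> 0"
  proof -
    have "0 < real m * (real m - real r)"
      using mr by simp
    with W show ?thesis by (simp add: X_def)
  qed
  have Y: "Y \<noteq> 0"
  proof -
    have "W \<le> real r * real r"
      unfolding W_def using z by (intro mult_mono) auto
    also have "\<dots> < real m * real m"
      using mr by (intro mult_strict_mono) auto
    also have "\<dots> \<le> (real r - 1) * (real m)\<^sup>2"
      using r_ge_2 mult_right_mono[of 1 "real r - 1" "(real m)\<^sup>2"] by (simp add: power2_eq_square)
    finally show ?thesis by (simp add: Y_def)
  qed
  define S where "S a a2 = (a\<^sup>2 - a2) / (real m * (real m - 1)) * (X / (real r)\<^sup>2)" for a a2 :: real
  define C where "C = ((\<Sum>k = 1..m. u k) * (\<Sum>k = 1..m. v k) - (\<Sum>k = 1..m. u k * v k)) /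
    (real m * (real m - 1)) * (Y / ((real r)\<^sup>2 * (real r - 1)))"
  have S: "E (\<lambda>w. \<Sum>k = 1..m. \<Sum>l\<in>{1..m} - {k}. u k * u l * ind w k s * ind w l s) =
      S (\<Sum>k = 1..m. u k) (\<Sum>k = 1..m. (u k)\<^sup>2)" if "s \<in> {1..r}" for u s
    unfolding E_sum_pairs_same[OF that] S_def X_def W_def z_def ..
  have C: "E (\<lambda>w. \<Sum>k = 1..m. \<Sum>l\<in>{1..m} - {k}. u k * v l * ind w k s * ind w l t) = C"
    unfolding E_sum_pairs_other[OF st] C_def Y_def W_def z_def ..
  \<comment> \<open>The denominators of the estimator are multiples of \<open>X\<close> and
    \<open>Y\<close>.\<close>
  have coeff: "(real m)\<^sup>2 * (real m - real r) + real m * z * (real r - z) = real m * X"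
    "real m ^ 3 * (real m - real r) + (real m)\<^sup>2 * z * (real r - z) = (real m)\<^sup>2 * X"
    "real m ^ 4 * (real r - 1) - (real m)\<^sup>2 * z * (real r - z) = (real m)\<^sup>2 * Y"
    "(real r)\<^sup>2 * z * (real r - z) = (real r)\<^sup>2 * W"
    "2 * (real r)\<^sup>2 * z * (real r - z) = 2 * (real r)\<^sup>2 * W"
    unfolding X_def Y_def W_def by algebra+
  have sigma: "E (block_sigma2_HT r m u s) =
      (real m - 1) * real r / (real m)\<^sup>2 * ((\<Sum>k = 1..m. (u k)\<^sup>2) / real r) -
      (real m - 1) * (real r)\<^sup>2 / (real m * X) * S (\<Sum>k = 1..m. u k) (\<Sum>k = 1..m. (u k)\<^sup>2)"
    if "s \<in> {1..r}" for u s
    unfolding block_sigma2_HT_def[abs_def] Let_def z_def[symmetric] coeff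
    by (simp only: Bochner_Integration.integral_diff integrable_assignment integral_mult_right_zero
        S[OF that] E_sum_group[OF that])
  have var_est: "E (block_var_HT r m u v s t) =
      r / (real m - 1) * (E (block_sigma2_HT r m u s) + E (block_sigma2_HT r m v t))
      + (real r)\<^sup>2 * W / ((real m)\<^sup>2 * X) * (S (\<Sum>k = 1..m. u k) (\<Sum>k = 1..m. (u k)\<^sup>2) +
          S (\<Sum>k = 1..m. v k) (\<Sum>k = 1..m. (v k)\<^sup>2))
      + 2 * (real r)\<^sup>2 * W / ((real m)\<^sup>2 * Y) * C"
    unfolding block_var_HT_def[abs_def] Let_def z_def[symmetric] coeff sum.distrib
    by (simp only: Bochner_Integration.integral_add integrable_assignment integral_mult_right_zero
        S[OF st(1)] S[OF st(2)] C)
  let ?U = "\<lambda>w. \<Sum>k = 1..m. u k * ind w k s" and ?V = "\<lambda>w. \<Sum>k = 1..m. v k * ind w k t"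
  have HT: "block_HT r m u v s t w = r / m * (?U w - ?V w)" for w
    by (simp add: block_HT_def sum_subtractf sum_distrib_left right_diff_distrib mult_ac)
  have sq: "E (\<lambda>w. (\<Sum>k = 1..m. u k * ind w k s)\<^sup>2) =
      S (\<Sum>k = 1..m. u k) (\<Sum>k = 1..m. (u k)\<^sup>2) + (\<Sum>k = 1..m. (u k)\<^sup>2) / r"
    if "s \<in> {1..r}" for u s
  proof -
    have "(\<Sum>k = 1..m. u k * ind w k s)\<^sup>2 =
        (\<Sum>k = 1..m. \<Sum>l\<in>{1..m} - {k}. u k * u l * ind w k s * ind w l s) +
        (\<Sum>k = 1..m. (u k)\<^sup>2 * ind w k s)" for w
      using sum_pairs_same_group[where m = m and u = u and w = w and s = s] by (simp add: mult_ac)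
    then show ?thesis
      by (simp only: Bochner_Integration.integral_add integrable_assignment S[OF that] E_sum_group[OF that])
  qed
  have cross: "E (\<lambda>w. ?U w * ?V w) = C"
    unfolding sum_pairs_other_group[OF st(3), symmetric] C[symmetric] by (simp add: mult_ac)
  have "E (\<lambda>w. (block_HT r m u v s t w)\<^sup>2) =
      (r / m)\<^sup>2 * (E (\<lambda>w. (?U w)\<^sup>2) + E (\<lambda>w. (?V w)\<^sup>2) - 2 * E (\<lambda>w. ?U w * ?V w))"
    unfolding HT power_mult_distrib power2_diff mult.assoc
    by (simp only: integral_mult_right_zero Bochner_Integration.integral_diff
        Bochner_Integration.integral_add integrable_assignment)
  moreover have "E (block_HT r m u v s t) =
      r / m * ((\<Sum>k = 1..m. u k) / r - (\<Sum>k = 1..m. v k) / r)"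
    unfolding HT[abs_def] integral_mult_right_zero
    by (simp only: Bochner_Integration.integral_diff integrable_assignment E_sum_group st)
  ultimately show ?thesis
    unfolding E_variance pop_var_diff var_est sigma[OF st(1)] sigma[OF st(2)]
    using HT_bias_identity[OF mr(1,2) X_def Y_def X Y]
    by (simp only: sq[OF st(1)] sq[OF st(2)] cross S_def C_def)
qed

end

subsection \<open>Combining the blocks\<close>

text \<open>Serves both estimators: \<open>X c\<close> is the estimator in block \<open>c\<close>,
  \<open>V c\<close> its variance estimate and \<open>D c\<close> the unit-level effects.
  Independence makes variances additive, so the total bias is a sum of nonnegative terms and
  vanishes only if each of them does.\<close>

lemma block_sum_variance_bias:
  fixes N :: "nat \<Rightarrow> nat" and X V :: "nat \<Rightarrow> (nat \<Rightarrow> nat) \<Rightarrow> real" and D :: "nat \<Rightarrow> nat \<Rightarrow> real"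
  assumes "r > 0" and N: "\<And>c. c \<in> {1..b} \<Longrightarrow> N c > 1"
    and P: "P = balanced_block_randomization r b N"
    and est: "\<And>a. est a = (\<Sum>c = 1..b. real (N c) / real (num_units b N) * X c (a c))"
    and var_est: "\<And>a. var_est a = (\<Sum>c = 1..b. (real (N c))\<^sup>2 / (real (num_units b N))\<^sup>2 * V c (a c))"
    and bias: "\<And>c. c \<in> {1..b} \<Longrightarrow>
      measure_pmf.expectation (pmf_of_set (balanced_assignments r (N c))) (V c) -
      measure_pmf.variance (pmf_of_set (balanced_assignments r (N c))) (X c) =
        pop_var (N c) (D c) / (real (N c) - 1)"
  shows "measure_pmf.variance P est \<le> measure_pmf.expectation P var_est"
    and "measure_pmf.expectation P var_est = measure_pmf.variance P est \<longleftrightarrow>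
      (\<forall>c\<in>{1..b}. \<exists>d. \<forall>k\<in>{1..N c}. D c k = d)"
proof -
  let ?p = "\<lambda>c. pmf_of_set (balanced_assignments r (N c))"
  let ?n = "real (num_units b N)"
  define g where "g c = (real (N c) / ?n)\<^sup>2 * (pop_var (N c) (D c) / (real (N c) - 1))" for c
  have fin: "finite (set_pmf (?p c))" for c
    using \<open>r > 0\<close> by (simp add: balanced_assignments_nonempty finite_balanced_assignments)
  have est': "est = (\<lambda>a. \<Sum>c = 1..b. real (N c) / ?n * X c (a c))"
    and var_est': "var_est = (\<lambda>a. \<Sum>c = 1..b. (real (N c))\<^sup>2 / ?n\<^sup>2 * V c (a c))"
    using est var_est by auto
  have exp: "measure_pmf.expectation P var_est =
      (\<Sum>c = 1..b. (real (N c) / ?n)\<^sup>2 * measure_pmf.expectation (?p c) (V c))"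
    unfolding P balanced_block_randomization_def var_est'
      expectation_sum_Pi_pmf[OF finite_atLeastAtMost fin,
        where f = "\<lambda>c w. (real (N c))\<^sup>2 / ?n\<^sup>2 * V c w"]
    by (simp add: power_divide)
  have "measure_pmf.variance (?p c) (\<lambda>w. real (N c) / ?n * X c w) =
      (real (N c) / ?n)\<^sup>2 * measure_pmf.variance (?p c) (X c)" for c
    by (simp only: integral_mult_right_zero right_diff_distrib[symmetric] power_mult_distrib)
  then have var: "measure_pmf.variance P est =
      (\<Sum>c = 1..b. (real (N c) / ?n)\<^sup>2 * measure_pmf.variance (?p c) (X c))"
    unfolding P balanced_block_randomization_def est'
      variance_sum_Pi_pmf[OF finite_atLeastAtMost fin,
        where f = "\<lambda>c w. real (N c) / ?n * X c w"]
    by (simp only:)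
  have diff: "measure_pmf.expectation P var_est - measure_pmf.variance P est = (\<Sum>c = 1..b. g c)"
    unfolding exp var sum_subtractf[symmetric] right_diff_distrib[symmetric] g_def
    by (intro sum.cong refl) (simp only: bias)
  have g0: "0 \<le> g c" if "c \<in> {1..b}" for c
    using N[OF that] by (simp add: g_def pop_var_nonneg)
  then show "measure_pmf.variance P est \<le> measure_pmf.expectation P var_est"
    using diff sum_nonneg[of "{1..b}" g] by simp
  have "g c = 0 \<longleftrightarrow> (\<exists>d. \<forall>k\<in>{1..N c}. D c k = d)" if c: "c \<in> {1..b}" for c
  proof -
    \<comment> \<open>Ensures \<open>n > 0\<close>, so the weight of the block is positive instead
      of the zero that division by zero would give.\<close>
    have "N c \<le> num_units b N"
      unfolding num_units_def using c by (intro member_le_sum) auto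
    then show ?thesis
      using N[OF c] by (simp add: g_def pop_var_eq_0_iff)
  qed
  moreover have "(\<Sum>c = 1..b. g c) = 0 \<longleftrightarrow> (\<forall>c\<in>{1..b}. g c = 0)"
    using g0 by (intro sum_nonneg_eq_0_iff) auto
  ultimately show "measure_pmf.expectation P var_est = measure_pmf.variance P est \<longleftrightarrow>
      (\<forall>c\<in>{1..b}. \<exists>d. \<forall>k\<in>{1..N c}. D c k = d)"
    unfolding eq_iff_diff_eq_0[of "measure_pmf.expectation P var_est"] diff by simp
qed

section \<open>The estimators as weighted sums over blocks\<close>

lemma treat_eq_ind: "treat a k c s = ind (a c) k s"
  by (simp add: treat_def ind_def)

lemma num_treat_eq_group_size: "num_treat N a c s = group_size (N c) (a c) s"
  by (simp add: num_treat_def group_size_def treat_eq_ind)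

lemma delta_diff_blocks:
  "delta_diff b N y s t a = (\<Sum>c = 1..b. real (N c) / real (num_units b N) *
    block_diff (N c) (\<lambda>k. y k c s) (\<lambda>k. y k c t) s t (a c))"
  by (simp only: delta_diff_def block_diff_def treat_eq_ind num_treat_eq_group_size)

lemma delta_HT_blocks:
  "delta_HT r b N y s t a = (\<Sum>c = 1..b. real (N c) / real (num_units b N) *
    block_HT r (N c) (\<lambda>k. y k c s) (\<lambda>k. y k c t) s t (a c))"
  by (simp only: delta_HT_def block_HT_def treat_eq_ind)

lemma var_est_diff_blocks:
  "var_est_diff r b N y s t a = (\<Sum>c = 1..b. (real (N c))\<^sup>2 / (real (num_units b N))\<^sup>2 *
    block_var_diff r (N c) (\<lambda>k. y k c s) (\<lambda>k. y k c t) s t (a c))"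
  by (simp only: var_est_diff_def block_var_diff_def sigma2_samp_def block_samp_def Let_def
      treat_eq_ind num_treat_eq_group_size)

lemma var_est_HT_blocks:
  "var_est_HT r b N y s t a = (\<Sum>c = 1..b. (real (N c))\<^sup>2 / (real (num_units b N))\<^sup>2 *
    block_var_HT r (N c) (\<lambda>k. y k c s) (\<lambda>k. y k c t) s t (a c))"
  by (simp only: var_est_HT_def block_var_HT_def sigma2_HT_def block_sigma2_HT_def Let_def
      treat_eq_ind)

theorem theorem8:
  fixes r b :: nat
    and N :: "nat \<Rightarrow> nat"
    and y :: "nat \<Rightarrow> nat \<Rightarrow> nat \<Rightarrow> real"
    and s t :: nat
    and P :: "(nat \<Rightarrow> nat \<Rightarrow> nat) pmf"
  assumes "\<forall>c \<in> {1..b}. N c \<ge> 2 * r"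
    and "s \<in> {1..r}" and "t \<in> {1..r}" and "s \<noteq> t"
    and "P = balanced_block_randomization r b N"
  shows "measure_pmf.expectation P (var_est_diff r b N y s t)
           \<ge> measure_pmf.variance P (delta_diff b N y s t)
       \<and> measure_pmf.expectation P (var_est_HT r b N y s t)
           \<ge> measure_pmf.variance P (delta_HT r b N y s t)
       \<and> (measure_pmf.expectation P (var_est_diff r b N y s t)
            = measure_pmf.variance P (delta_diff b N y s t)
          \<longleftrightarrow> (\<forall>c \<in> {1..b}. \<exists>a. \<forall>k \<in> {1..N c}. y k c s = a + y k c t))
       \<and> (measure_pmf.expectation P (var_est_HT r b N y s t)
            = measure_pmf.variance P (delta_HT r b N y s t)
          \<longleftrightarrow> (\<forall>c \<in> {1..b}. \<exists>a. \<forall>k \<in> {1..N c}. y k c s = a + y k c t))"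
proof -
  have r: "2 \<le> r"
    using assms(2,3,4) by auto
  have block: "balanced_block r (N c)" if "c \<in> {1..b}" for c
    using r assms(1) that by (simp add: balanced_block_def)
  have N: "N c > 1" if "c \<in> {1..b}" for c
    using r assms(1) that by fastforce
  have "r > 0"
    using r by simp
  have shift: "(\<exists>d. \<forall>k\<in>{1..N c}. y k c s - y k c t = d) \<longleftrightarrow>
      (\<exists>a. \<forall>k\<in>{1..N c}. y k c s = a + y k c t)" for c
    by (simp add: algebra_simps)
  \<comment> \<open>The unit-level effects are \<open>y k c s - y k c t\<close>;
    \<open>shift\<close> turns their constancy within a block into the stated condition.\<close>
  note diff = block_sum_variance_bias[OF \<open>r > 0\<close> N assms(5) delta_diff_blocks[where y = y]
      var_est_diff_blocks[where y = y]
      balanced_block.block_diff_bias[OF block assms(2-4)], unfolded shift]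
  note HT = block_sum_variance_bias[OF \<open>r > 0\<close> N assms(5) delta_HT_blocks[where y = y]
      var_est_HT_blocks[where y = y]
      balanced_block.block_HT_bias[OF block assms(2-4)], unfolded shift]
  show ?thesis
    using diff HT by blast
qed

end
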